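(* Let $\mathcal{D}$ be a Dirac operator on the spinor bundle $\mathcal{E}$ over $S^2$ with a one-dimensional real-valued potential $U(x)$, $U(x)=O(e^{-|x|})$ as $x\to\pm\infty$, in some cylindric representation (for instance, a Dirac operator generating an immersion of a sphere of revolution). If $$\dim_{\bf H}\mathrm{Ker}\,\mathcal{D}=\frac{\dim_{\mathbb{C}}\mathrm{Ker}\,\mathcal{D}}{2}\ \ge\ N,$$ then $$\int_{-\infty}^{+\infty}U^2(x)\,dx\ \ge\ \frac{N^2}{2}.$$
   Context: Notation: $z=x+iy$ is a conformal parameter on the cylinder $\mathcal{Z}=\{(x,y):-\infty<x<\infty,\ y\bmod 2\pi\}$, $\partial=\frac12(\partial_x-i\partial_y)$, $\bar\partial=\frac12(\partial_x+i\partial_y)$, and $$\mathcal{D}=\begin{pmatrix}0&\partial\\-\bar\partial&0\end{pmatrix}+\begin{pmatrix}U&0\\0&U\end{pmatrix}.$$ The sphere is the cylinder $\mathcal{Z}$ completed by adding a point at each end. In the cylindric representation, $\mathrm{Ker}\,\mathcal{D}$ for $\mathcal{D}$ acting on sections of $\mathcal{E}$ is the complex vector space of solutions $\psi:\mathbb{R}^2\to\mathbb{C}^2$ of $\mathcal{D}\psi=0$ with $\psi(x,y+2\pi)=-\psi(x,y)$ and $|\psi|^2=O(e^{-|x|})$ as $x\to\pm\infty$. It is finite-dimensional and invariant under $\psi=(\psi_1,\psi_2)\mapsto\psi^*=(\bar\psi_2,-\bar\psi_1)$, which satisfies $(\psi^* )^*=-\psi$; this makes it a quaternionic vector space, with $\dim_{\bf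 H}=\frac12\dim_{\mathbb{C}}$. "One-dimensional potential" means that $U$ depends on $x$ only. *)

theory Defs
  imports
    "HOL-Analysis.Analysis"
    "HOL-Library.Function_Algebras"
    "HOL-Library.Landau_Symbols"
begin

type_synonym spinor = "real \<times> real \<Rightarrow> complex ^ 2"

definition partial_x :: "(real \<times> real \<Rightarrow> 'a::real_normed_vector) \<Rightarrow> real \<times> real \<Rightarrow> 'a" where
  "partial_x f p = vector_derivative (\<lambda>s. f (s, snd p)) (at (fst p))"

definition partial_y :: "(real \<times> real \<Rightarrow> 'a::real_normed_vector) \<Rightarrow> real \<times> real \<Rightarrow> 'a" where
  "partial_y f p = vector_derivative (\<lambda>t. f (fst p, t)) (at (snd p))"

definition wirtinger :: "(real \<times> real \<Rightarrow> complex) \<Rightarrow> real \<times> real \<Rightarrow> complex" where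
  "wirtinger f p = (partial_x f p - \<i> * partial_y f p) / 2"

definition wirtinger_bar :: "(real \<times> real \<Rightarrow> complex) \<Rightarrow> real \<times> real \<Rightarrow> complex" where
  "wirtinger_bar f p = (partial_x f p + \<i> * partial_y f p) / 2"

definition dirac :: "(real \<times> real \<Rightarrow> real) \<Rightarrow> spinor \<Rightarrow> spinor" where
  "dirac V \<psi> p = vector
     [wirtinger (\<lambda>q. \<psi> q $ 2) p + of_real (V p) * (\<psi> p $ 1),
      - wirtinger_bar (\<lambda>q. \<psi> q $ 1) p + of_real (V p) * (\<psi> p $ 2)]"

(* vector_derivative is unspecified where the derivative does not exist, so "D \<psi> = 0" is meaningful
   only together with a regularity requirement; solutions are classical (C^1) ones. *)
definition C1_spinor :: "spinor \<Rightarrow> bool" where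
  "C1_spinor \<psi> \<longleftrightarrow> (\<exists>\<psi>' :: real \<times> real \<Rightarrow> (real \<times> real) \<Rightarrow>\<^sub>L (complex ^ 2).
     (\<forall>p. (\<psi> has_derivative blinfun_apply (\<psi>' p)) (at p)) \<and> continuous_on UNIV \<psi>')"

(* The filter filtercomap fst at_infinity is "x \<rightarrow> \<plusminus>\<infinity>, uniformly in y". *)
definition dirac_ker :: "(real \<times> real \<Rightarrow> real) \<Rightarrow> spinor set" where
  "dirac_ker V = {\<psi>. C1_spinor \<psi> \<and> (\<forall>p. dirac V \<psi> p = 0) \<and>
     (\<forall>x y. \<psi> (x, y + 2 * pi) = - \<psi> (x, y)) \<and>
     (\<lambda>p. (norm (\<psi> p))\<^sup>2) \<in> O[filtercomap fst at_infinity](\<lambda>p. exp (- \<bar>fst p\<bar>))}"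

definition spinor_scale :: "complex \<Rightarrow> spinor \<Rightarrow> spinor" where
  "spinor_scale c \<psi> = (\<lambda>p. c *s \<psi> p)"

interpretation spinor: vector_space spinor_scale
  by unfold_locales
    (simp_all add: spinor_scale_def fun_eq_iff vector_add_ldistrib vector_sadd_rdistrib
      vector_smult_assoc)

definition spinor_star :: "spinor \<Rightarrow> spinor" where
  "spinor_star \<psi> p = vector [cnj (\<psi> p $ 2), - cnj (\<psi> p $ 1)]"

lemma spinor_star_star: "spinor_star (spinor_star \<psi>) = - \<psi>"
  by (simp add: spinor_star_def fun_eq_iff vec_eq_iff forall_2)

lemma C1_spinor_bounded_linear:
  assumes "bounded_linear L" "C1_spinor \<psi>"
  shows "C1_spinor (\<lambda>p. L (\<psi> p))"
proof -
  from assms(2) obtain \<psi>' where d: "\<And>p. (\<psi> has_derivative blinfun_apply (\<psi>' p)) (at p)"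
    and c: "continuous_on UNIV \<psi>'"
    unfolding C1_spinor_def by blast
  have "((\<lambda>p. L (\<psi> p)) has_derivative blinfun_apply (Blinfun L o\<^sub>L \<psi>' p)) (at p)" for p
    using bounded_linear.has_derivative[OF assms(1) d]
    by (simp add: blinfun_compose.rep_eq bounded_linear_Blinfun_apply[OF assms(1)] o_def)
  moreover have "continuous_on UNIV (\<lambda>p. Blinfun L o\<^sub>L \<psi>' p)"
    by (intro continuous_intros c)
  ultimately show ?thesis
    unfolding C1_spinor_def by (intro exI[of _ "\<lambda>p. Blinfun L o\<^sub>L \<psi>' p"]) simp
qed

lemma C1_spinor_add:
  assumes "C1_spinor \<phi>" "C1_spinor \<psi>"
  shows "C1_spinor (\<phi> + \<psi>)"
proof -
  from assms obtain \<phi>' \<psi>' where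
    d: "\<And>p. (\<phi> has_derivative blinfun_apply (\<phi>' p)) (at p)" "continuous_on UNIV \<phi>'"
       "\<And>p. (\<psi> has_derivative blinfun_apply (\<psi>' p)) (at p)" "continuous_on UNIV \<psi>'"
    unfolding C1_spinor_def by blast
  have "((\<phi> + \<psi>) has_derivative blinfun_apply (\<phi>' p + \<psi>' p)) (at p)" for p
    using has_derivative_add[OF d(1) d(3), of p] by (simp add: plus_fun_def plus_blinfun.rep_eq)
  moreover have "continuous_on UNIV (\<lambda>p. \<phi>' p + \<psi>' p)"
    by (intro continuous_intros d)
  ultimately show ?thesis
    unfolding C1_spinor_def by (intro exI[of _ "\<lambda>p. \<phi>' p + \<psi>' p"]) simp
qed

lemma C1_spinor_has_partials:
  assumes "C1_spinor \<psi>"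
  shows "((\<lambda>s. \<psi> (s, y) $ i) has_vector_derivative partial_x (\<lambda>q. \<psi> q $ i) (x, y)) (at x)"
    and "((\<lambda>t. \<psi> (x, t) $ i) has_vector_derivative partial_y (\<lambda>q. \<psi> q $ i) (x, y)) (at y)"
proof -
  from assms obtain \<psi>' where d: "\<And>p. (\<psi> has_derivative blinfun_apply (\<psi>' p)) (at p)"
    unfolding C1_spinor_def by blast
  have di: "((\<lambda>q. \<psi> q $ i) has_derivative (\<lambda>h. blinfun_apply (\<psi>' p) h $ i)) (at p)" for p
    by (rule bounded_linear.has_derivative[OF bounded_linear_vec_nth d])
  have "(\<lambda>s. \<psi> (s, y) $ i) differentiable (at x)"
    unfolding differentiable_def
    by (rule exI, rule has_derivative_compose[of "\<lambda>s. (s, y)", OF _ di])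
      (rule has_derivative_Pair has_derivative_ident has_derivative_const)+
  then show "((\<lambda>s. \<psi> (s, y) $ i) has_vector_derivative partial_x (\<lambda>q. \<psi> q $ i) (x, y)) (at x)"
    by (simp add: vector_derivative_works partial_x_def)
  have "(\<lambda>t. \<psi> (x, t) $ i) differentiable (at y)"
    unfolding differentiable_def
    by (rule exI, rule has_derivative_compose[of "\<lambda>t. (x, t)", OF _ di])
      (rule has_derivative_Pair has_derivative_ident has_derivative_const)+
  then show "((\<lambda>t. \<psi> (x, t) $ i) has_vector_derivative partial_y (\<lambda>q. \<psi> q $ i) (x, y)) (at y)"
    by (simp add: vector_derivative_works partial_y_def)
qed

lemma partial_eqI:
  "((\<lambda>s. f (s, snd p)) has_vector_derivative d) (at (fst p)) \<Longrightarrow> partial_x f p = d"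
  "((\<lambda>t. f (fst p, t)) has_vector_derivative d) (at (snd p)) \<Longrightarrow> partial_y f p = d"
  by (simp_all add: partial_x_def partial_y_def vector_derivative_at)

lemma dirac_add:
  assumes "C1_spinor \<phi>" "C1_spinor \<psi>"
  shows "dirac V (\<phi> + \<psi>) p = dirac V \<phi> p + dirac V \<psi> p"
proof -
  have "partial_x (\<lambda>q. (\<phi> + \<psi>) q $ i) p = partial_x (\<lambda>q. \<phi> q $ i) p + partial_x (\<lambda>q. \<psi> q $ i) p"
    "partial_y (\<lambda>q. (\<phi> + \<psi>) q $ i) p = partial_y (\<lambda>q. \<phi> q $ i) p + partial_y (\<lambda>q. \<psi> q $ i) p"
    for i
    using has_vector_derivative_add[OF C1_spinor_has_partials(1)[OF assms(1), of "snd p" i "fst p"]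
        C1_spinor_has_partials(1)[OF assms(2), of "snd p" i "fst p"]]
      has_vector_derivative_add[OF C1_spinor_has_partials(2)[OF assms(1), of "fst p" i "snd p"]
        C1_spinor_has_partials(2)[OF assms(2), of "fst p" i "snd p"]]
    by (auto intro!: partial_eqI)
  then show ?thesis
    by (simp add: dirac_def vec_eq_iff forall_2 wirtinger_def wirtinger_bar_def field_simps)
qed

lemma dirac_scale:
  assumes "C1_spinor \<psi>"
  shows "dirac V (spinor_scale c \<psi>) p = c *s dirac V \<psi> p"
proof -
  have "partial_x (\<lambda>q. spinor_scale c \<psi> q $ i) p = c * partial_x (\<lambda>q. \<psi> q $ i) p"
    "partial_y (\<lambda>q. spinor_scale c \<psi> q $ i) p = c * partial_y (\<lambda>q. \<psi> q $ i) p"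
    for i
    using has_vector_derivative_mult_right[OF C1_spinor_has_partials(1)[OF assms, of "snd p" i "fst p"], of c]
      has_vector_derivative_mult_right[OF C1_spinor_has_partials(2)[OF assms, of "fst p" i "snd p"], of c]
    by (auto simp: spinor_scale_def intro!: partial_eqI)
  then show ?thesis
    by (simp add: dirac_def vec_eq_iff forall_2 wirtinger_def wirtinger_bar_def field_simps
        spinor_scale_def)
qed

lemma dirac_star:
  assumes "C1_spinor \<psi>"
  shows "dirac V (spinor_star \<psi>) p = spinor_star (dirac V \<psi>) p"
proof -
  have "partial_x (\<lambda>q. cnj (\<psi> q $ i)) p = cnj (partial_x (\<lambda>q. \<psi> q $ i) p)"
    "partial_y (\<lambda>q. cnj (\<psi> q $ i)) p = cnj (partial_y (\<lambda>q. \<psi> q $ i) p)"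
    "partial_x (\<lambda>q. - cnj (\<psi> q $ i)) p = - cnj (partial_x (\<lambda>q. \<psi> q $ i) p)"
    "partial_y (\<lambda>q. - cnj (\<psi> q $ i)) p = - cnj (partial_y (\<lambda>q. \<psi> q $ i) p)"
    for i
    using has_vector_derivative_cnj[OF C1_spinor_has_partials(1)[OF assms, of "snd p" i "fst p"]]
      has_vector_derivative_cnj[OF C1_spinor_has_partials(2)[OF assms, of "fst p" i "snd p"]]
    by (auto intro!: partial_eqI has_vector_derivative_minus)
  then show ?thesis
    by (simp add: dirac_def vec_eq_iff forall_2 wirtinger_def wirtinger_bar_def field_simps
        spinor_star_def)
qed

lemma norm_spinor_star: "norm (spinor_star \<psi> p) = norm (\<psi> p)"
  by (simp add: spinor_star_def norm_vec_def L2_set_def sum_2 add.commute)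

lemma spinor_star_dirac_ker:
  assumes "\<psi> \<in> dirac_ker V"
  shows "spinor_star \<psi> \<in> dirac_ker V"
proof -
  have c: "C1_spinor \<psi>"
    using assms by (simp add: dirac_ker_def)
  have "bounded_linear (\<lambda>v :: complex ^ 2. vector [cnj (v $ 2), - cnj (v $ 1)] :: complex ^ 2)"
    by (rule linear_conv_bounded_linear[THEN iffD1], rule linearI)
      (simp_all add: vec_eq_iff forall_2)
  from C1_spinor_bounded_linear[OF this c] have "C1_spinor (spinor_star \<psi>)"
    by (simp add: spinor_star_def[abs_def])
  moreover have "dirac V (spinor_star \<psi>) p = 0" for p
  proof -
    have "dirac V \<psi> p = 0"
      using assms unfolding dirac_ker_def by blast
    then show ?thesis
      by (simp add: dirac_star[OF c] spinor_star_def vec_eq_iff forall_2)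
  qed
  moreover have "spinor_star \<psi> (x, y + 2 * pi) = - spinor_star \<psi> (x, y)" for x y
    using assms by (simp add: spinor_star_def dirac_ker_def vec_eq_iff forall_2)
  ultimately show ?thesis
    using assms by (simp add: dirac_ker_def norm_spinor_star)
qed

lemma subspace_dirac_ker: "spinor.subspace (dirac_ker V)"
proof (rule spinor.subspaceI)
  show "0 \<in> dirac_ker V"
    by (auto simp: dirac_ker_def C1_spinor_def dirac_def wirtinger_def wirtinger_bar_def
        partial_x_def partial_y_def vec_eq_iff forall_2 zero_fun_def zero_blinfun.rep_eq
        intro!: exI[of _ "\<lambda>_. 0"])
next
  fix \<phi> \<psi> assume a: "\<phi> \<in> dirac_ker V" "\<psi> \<in> dirac_ker V"
  have "(\<lambda>p. (norm ((\<phi> + \<psi>) p))\<^sup>2) \<in> O[filtercomap fst at_infinity](\<lambda>p. 2 * (norm (\<phi> p))\<^sup>2 + 2 * (norm (\<psi> p))\<^sup>2)"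
  proof (rule bigoI[of _ 1], rule always_eventually, rule allI)
    fix p
    have "(norm ((\<phi> + \<psi>) p))\<^sup>2 \<le> (norm (\<phi> p) + norm (\<psi> p))\<^sup>2"
      by (intro power_mono) (simp_all add: norm_triangle_ineq)
    also have "\<dots> \<le> 2 * (norm (\<phi> p))\<^sup>2 + 2 * (norm (\<psi> p))\<^sup>2"
      using sum_squares_bound[of "norm (\<phi> p)" "norm (\<psi> p)"] by (simp add: power2_sum)
    finally show "norm ((norm ((\<phi> + \<psi>) p))\<^sup>2) \<le> 1 * norm (2 * (norm (\<phi> p))\<^sup>2 + 2 * (norm (\<psi> p))\<^sup>2)"
      by simp
  qed
  also have "(\<lambda>p. 2 * (norm (\<phi> p))\<^sup>2 + 2 * (norm (\<psi> p))\<^sup>2)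
      \<in> O[filtercomap fst at_infinity](\<lambda>p. exp (- \<bar>fst p\<bar>))"
    using a by (intro sum_in_bigo) (simp_all add: dirac_ker_def)
  finally show "\<phi> + \<psi> \<in> dirac_ker V"
    using a by (simp add: dirac_ker_def C1_spinor_add dirac_add)
next
  fix c \<psi> assume a: "\<psi> \<in> dirac_ker V"
  have "bounded_linear (\<lambda>v :: complex ^ 2. c *s v)"
    by (rule linear_conv_bounded_linear[THEN iffD1], rule linearI)
      (simp_all add: vec_eq_iff algebra_simps)
  from C1_spinor_bounded_linear[OF this, of \<psi>] a have "C1_spinor (spinor_scale c \<psi>)"
    by (simp add: dirac_ker_def spinor_scale_def)
  moreover have "norm (c *s v) = cmod c * norm v" for v :: "complex ^ 2"
    by (simp add: vector_scalar_mult_def norm_vec_def norm_mult L2_set_right_distrib)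
  ultimately have n: "C1_spinor (spinor_scale c \<psi>)"
      "norm (spinor_scale c \<psi> p) = cmod c * norm (\<psi> p)" for p
    by (simp_all add: spinor_scale_def)
  have "spinor_scale c \<psi> (x, y + 2 * pi) = - spinor_scale c \<psi> (x, y)" for x y
    using a by (simp add: dirac_ker_def spinor_scale_def vec_eq_iff)
  with a n show "spinor_scale c \<psi> \<in> dirac_ker V"
    by (simp add: dirac_ker_def dirac_scale power_mult_distrib)
qed

(* Quaternionic dimension of a complex subspace invariant under spinor_star, which is the
   quaternionic structure.  The library's dim is 0 on infinite-dimensional spaces. *)
definition dim_H :: "spinor set \<Rightarrow> real" where
  "dim_H W = real (spinor.dim W) / 2"

end

theory Submission
  imports Defs
begin

text \<open>
  Separating the variable \<open>y\<close>, the coefficient of \<open>e\<^bsup>iky\<^esup>\<close>, \<open>k\<close> a half-integer, of a kernel element is a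
  decaying solution of the Zakharov-Shabat system \<open>f' = k f + u g\<close>, \<open>g' = - k g - u f\<close> with \<open>u = 2 U\<close>.
  For each \<open>k\<close> such solutions form a space of dimension at most one, and \<open>k\<close> is an eigenvalue iff
  \<open>-k\<close> is; hence there are at least \<open>N\<close> positive eigenvalues, and their sum is at least
  \<open>1/2 + 3/2 + \<dots> + (N - 1/2) = N\<^sup>2 / 2\<close>.  A Darboux transformation removes one eigenvalue \<open>k\<close>, keeps the
  others, and lowers \<open>\<integral>u\<^sup>2\<close> by exactly \<open>4 k\<close>; therefore \<open>\<integral>u\<^sup>2\<close> is at least four times the sum of the
  positive eigenvalues.
\<close>

subsection \<open>The Zakharov-Shabat system\<close>

text \<open>\<open>U\<close> is assumed to decay, but not to be continuous or even measurable.
  Continuity comes from the kernel: the two components of a nonzero mode have no common zero, so the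
  system can be solved for \<open>U\<close>. The constant 4 k is a boundary term. If c and s are the
  cosine and sine of twice the polar angle of the bound state, then (u + 2 k s)^2 - u^2 = 2 k c',
  and c falls from 1 to -1: for k > 0 a decaying solution leaves -infinity along the f-axis and
  reaches +infinity along the g-axis. As the Darboux step is iterated, the induction may rest only
  on what a step preserves: the potential is continuous and tends to 0. Square integrals are
  therefore compared on [-b, b] up to an arbitrary error, and integrability enters only at the end,
  for \<open>U\<close> itself. Bounding the dimension of the kernel by the number of eigenvalues
  requires that a kernel element be determined by its modes; this is completeness of the functions
  e^(iny), obtained from Stone-Weierstrass. The set of eigenvalues may a priori be infinite, and
  then any \<open>N\<close> positive ones will do.\<close>

definition zs :: "(real \<Rightarrow> real) \<Rightarrow> real \<Rightarrow> (real \<Rightarrow> 'a::real_normed_vector) \<Rightarrow> (real \<Rightarrow> 'a) \<Rightarrow> bool"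
  where "zs u k f g \<longleftrightarrow> (\<forall>x.
    (f has_vector_derivative k *\<^sub>R f x + u x *\<^sub>R g x) (at x) \<and>
    (g has_vector_derivative - k *\<^sub>R g x - u x *\<^sub>R f x) (at x))"

definition bound_state :: "(real \<Rightarrow> real) \<Rightarrow> real \<Rightarrow> (real \<Rightarrow> 'a::real_normed_vector) \<Rightarrow> (real \<Rightarrow> 'a) \<Rightarrow> bool"
  where "bound_state u k f g \<longleftrightarrow> zs u k f g \<and> (f \<longlongrightarrow> 0) at_infinity \<and> (g \<longlongrightarrow> 0) at_infinity \<and>
    (\<exists>x. f x \<noteq> 0 \<or> g x \<noteq> 0)"

text \<open>The coefficients of the system are real scalars. This lets \<open>Re\<close>,
  \<open>Im\<close>, \<open>of_real\<close> and multiplication by a complex constant pass through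
  it.\<close>

lemma zs_bounded_linear:
  assumes "bounded_linear L" "zs u k f g"
  shows "zs u k (\<lambda>x. L (f x)) (\<lambda>x. L (g x))"
proof -
  interpret bounded_linear L by fact
  show ?thesis
    using assms(2) has_vector_derivative[of f] has_vector_derivative[of g]
    unfolding zs_def by (metis (no_types, lifting) add diff scaleR)
qed

lemma zs_diff:
  assumes "zs u k f g" "zs u k f' g'"
  shows "zs u k (\<lambda>x. f x - f' x) (\<lambda>x. g x - g' x)"
  unfolding zs_def
proof (intro allI conjI)
  fix x
  show "((\<lambda>x. f x - f' x) has_vector_derivative k *\<^sub>R (f x - f' x) + u x *\<^sub>R (g x - g' x)) (at x)"
    using assms unfolding zs_def
    by (intro has_vector_derivative_eq_rhs[OF has_vector_derivative_diff]) (blast | simp add: algebra_simps)+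
  show "((\<lambda>x. g x - g' x) has_vector_derivative - k *\<^sub>R (g x - g' x) - u x *\<^sub>R (f x - f' x)) (at x)"
    using assms unfolding zs_def
    by (intro has_vector_derivative_eq_rhs[OF has_vector_derivative_diff]) (blast | simp add: algebra_simps)+
qed

lemma zs_real_iff:
  fixes f g :: "real \<Rightarrow> real"
  shows "zs u k f g \<longleftrightarrow> (\<forall>x. (f has_real_derivative k * f x + u x * g x) (at x) \<and>
    (g has_real_derivative - k * g x - u x * f x) (at x))"
  by (simp add: zs_def has_real_derivative_iff_has_vector_derivative)

text \<open>The real form of \<open>spinor_star\<close> on a single mode; it pairs the eigenvalue
  \<open>k\<close> with \<open>- k\<close>.\<close>

lemma zs_swap_neg:
  fixes f g :: "real \<Rightarrow> real"
  assumes "zs u k f g"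
  shows "zs u (- k) g (\<lambda>x. - f x)"
  using assms unfolding zs_real_iff by (auto intro!: derivative_eq_intros simp: algebra_simps)

lemma zs_reflect:
  fixes f g :: "real \<Rightarrow> real"
  assumes "zs u k f g"
  shows "zs (\<lambda>x. u (- x)) k (\<lambda>x. g (- x)) (\<lambda>x. f (- x))"
  unfolding zs_real_iff
proof (intro allI conjI)
  fix x
  have "(f has_real_derivative k * f (-x) + u (-x) * g (-x)) (at (-x))"
    "(g has_real_derivative - k * g (-x) - u (-x) * f (-x)) (at (-x))"
    using assms unfolding zs_real_iff by auto
  then show "((\<lambda>x. g (- x)) has_real_derivative k * g (- x) + u (- x) * f (- x)) (at x)"
    "((\<lambda>x. f (- x)) has_real_derivative - k * f (- x) - u (- x) * g (- x)) (at x)"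
    unfolding DERIV_mirror[of _ _ x] by (simp_all add: algebra_simps)
qed

text \<open>The potential cancels in the derivative of \<open>f\<^sup>2 + g\<^sup>2\<close>, so uniqueness needs no regularity of \<open>u\<close>.\<close>

lemma zs_real_unique:
  fixes f g :: "real \<Rightarrow> real"
  assumes z: "zs u k f g" and 0: "f a = 0" "g a = 0"
  shows "f x = 0 \<and> g x = 0"
proof -
  have fd: "\<And>x. (f has_real_derivative k * f x + u x * g x) (at x)"
    and gd: "\<And>x. (g has_real_derivative - k * g x - u x * f x) (at x)"
    using z unfolding zs_real_iff by auto
  define R where "R = (\<lambda>x. (f x)\<^sup>2 + (g x)\<^sup>2)"
  have R0: "R x \<ge> 0" for x by (simp add: R_def)
  have Rd: "(R has_real_derivative 2 * k * ((f x)\<^sup>2 - (g x)\<^sup>2)) (at x)" for x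
    unfolding R_def by (auto intro!: derivative_eq_intros fd gd simp: power2_eq_square algebra_simps)
  have bnd: "\<bar>2 * k * ((f x)\<^sup>2 - (g x)\<^sup>2)\<bar> \<le> 2 * \<bar>k\<bar> * R x" for x
  proof -
    have "\<bar>(f x)\<^sup>2 - (g x)\<^sup>2\<bar> \<le> R x" unfolding R_def by (auto simp: abs_if)
    then show ?thesis by (simp add: abs_mult mult_left_mono)
  qed
  have "R x \<le> 0"
  proof (cases "a \<le> x")
    case True
    \<comment> \<open>Gronwall by weights: as |R'| <= 2 |k| R, the factor exp (-2 |k| x) makes
      \<open>R\<close> nonincreasing, which settles the points right of \<open>a\<close>; exp (2 |k|
      x) makes it nondecreasing, for the points left of \<open>a\<close>.\<close>
    have "R x * exp (- 2 * \<bar>k\<bar> * x) \<le> R a * exp (- 2 * \<bar>k\<bar> * a)"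
    proof (rule DERIV_nonpos_imp_nonincreasing[OF True])
      fix y assume "a \<le> y" "y \<le> x"
      have "((\<lambda>x. R x * exp (- 2 * \<bar>k\<bar> * x)) has_real_derivative
          (2 * k * ((f y)\<^sup>2 - (g y)\<^sup>2) - 2 * \<bar>k\<bar> * R y) * exp (- 2 * \<bar>k\<bar> * y)) (at y)"
        by (auto intro!: derivative_eq_intros Rd simp: algebra_simps)
      moreover have "(2 * k * ((f y)\<^sup>2 - (g y)\<^sup>2) - 2 * \<bar>k\<bar> * R y) * exp (- 2 * \<bar>k\<bar> * y) \<le> 0"
        using bnd[of y] by (intro mult_nonpos_nonneg) auto
      ultimately show "\<exists>z. ((\<lambda>x. R x * exp (- 2 * \<bar>k\<bar> * x)) has_real_derivative z) (at y) \<and> z \<le> 0"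
        by blast
    qed
    then have "R x * exp (- 2 * \<bar>k\<bar> * x) \<le> 0" by (simp add: R_def 0)
    then show ?thesis by (simp add: mult_le_0_iff)
  next
    case False
    then have xa: "x \<le> a" by simp
    have "R x * exp (2 * \<bar>k\<bar> * x) \<le> R a * exp (2 * \<bar>k\<bar> * a)"
    proof (rule DERIV_nonneg_imp_nondecreasing[OF xa])
      fix y
      have "((\<lambda>x. R x * exp (2 * \<bar>k\<bar> * x)) has_real_derivative
          (2 * k * ((f y)\<^sup>2 - (g y)\<^sup>2) + 2 * \<bar>k\<bar> * R y) * exp (2 * \<bar>k\<bar> * y)) (at y)"
        by (auto intro!: derivative_eq_intros Rd simp: algebra_simps)
      moreover have "(2 * k * ((f y)\<^sup>2 - (g y)\<^sup>2) + 2 * \<bar>k\<bar> * R y) * exp (2 * \<bar>k\<bar> * y) \<ge> 0"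
        using bnd[of y] by (intro mult_nonneg_nonneg) auto
      ultimately show "\<exists>z. ((\<lambda>x. R x * exp (2 * \<bar>k\<bar> * x)) has_real_derivative z) (at y) \<and> 0 \<le> z"
        by blast
    qed
    then have "R x * exp (2 * \<bar>k\<bar> * x) \<le> 0" by (simp add: R_def 0)
    then show ?thesis by (simp add: mult_le_0_iff)
  qed
  then show ?thesis
    by (simp add: R_def sum_power2_le_zero_iff)
qed

lemma zs_complex_unique:
  fixes f g :: "real \<Rightarrow> complex"
  assumes "zs u k f g" "f a = 0" "g a = 0"
  shows "f x = 0 \<and> g x = 0"
  using zs_real_unique[OF zs_bounded_linear[OF bounded_linear_Re assms(1)], of a x]
    zs_real_unique[OF zs_bounded_linear[OF bounded_linear_Im assms(1)], of a x] assms
  by (simp add: complex_eq_iff)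

text \<open>A common zero would force the solution to vanish identically. This makes the quotients
  defining \<open>zs_cos\<close> and \<open>zs_sin\<close> meaningful at every point.\<close>

lemma bound_state_pos:
  fixes f g :: "real \<Rightarrow> real"
  assumes "bound_state u k f g"
  shows "(f x)\<^sup>2 + (g x)\<^sup>2 > 0"
  using assms zs_real_unique[of u k f g x] unfolding bound_state_def
  by (metis sum_power2_gt_zero_iff)

text \<open>The Wronskian is constant, and it vanishes at infinity.\<close>

lemma bound_state_proportional:
  fixes f g p q :: "real \<Rightarrow> complex"
  assumes b: "bound_state u k f g"
    and z: "zs u k p q" and p0: "(p \<longlongrightarrow> 0) at_infinity" and q0: "(q \<longlongrightarrow> 0) at_infinity"
  shows "\<exists>c. \<forall>x. p x = c * f x \<and> q x = c * g x"
proof -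
  have zf: "zs u k f g" and f0: "(f \<longlongrightarrow> 0) at_infinity" and g0: "(g \<longlongrightarrow> 0) at_infinity"
    using b by (auto simp: bound_state_def)
  obtain a where a: "f a \<noteq> 0 \<or> g a \<noteq> 0" using b by (auto simp: bound_state_def)
  define W where "W = (\<lambda>x. f x * q x - g x * p x)"
  have "(W has_vector_derivative 0) (at x)" for x
  proof -
    have d: "(f has_vector_derivative k *\<^sub>R f x + u x *\<^sub>R g x) (at x)"
       "(g has_vector_derivative - k *\<^sub>R g x - u x *\<^sub>R f x) (at x)"
       "(p has_vector_derivative k *\<^sub>R p x + u x *\<^sub>R q x) (at x)"
       "(q has_vector_derivative - k *\<^sub>R q x - u x *\<^sub>R p x) (at x)"
      using zf z unfolding zs_def by auto
    show ?thesis
      unfolding W_def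
      by (rule has_vector_derivative_eq_rhs[OF has_vector_derivative_diff[OF
            has_vector_derivative_mult[OF d(1) d(4)] has_vector_derivative_mult[OF d(2) d(3)]]])
        (simp add: algebra_simps)
  qed
  then obtain w where w: "\<And>x. W x = w"
    using has_vector_derivative_zero_constant[of UNIV W] by auto
  have "(W \<longlongrightarrow> 0) at_infinity"
    unfolding W_def by (rule tendsto_eq_intros f0 g0 p0 q0 | simp)+
  then have "w = 0"
    using tendsto_unique[OF trivial_limit_at_infinity _ tendsto_const] w
    by (metis (no_types, lifting) ext)
  then have W0: "f a * q a = g a * p a" using w[of a] by (simp add: W_def)
  \<comment> \<open>Divide by a component of (f, g) that is nonzero at \<open>a\<close>. The
    vanishing Wronskian makes the other component match too, so uniqueness applies to the
    difference.\<close>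
  define c where "c = (if f a \<noteq> 0 then p a / f a else q a / g a)"
  have ca: "p a = c * f a" "q a = c * g a"
    using a W0 by (auto simp: c_def field_simps)
  have "zs u k (\<lambda>x. p x - c * f x) (\<lambda>x. q x - c * g x)"
    using zs_diff[OF z zs_bounded_linear[OF bounded_linear_mult_right[of c] zf]] .
  from zs_complex_unique[OF this, of a] show ?thesis
    by (intro exI[of _ c]) (auto simp: ca)
qed

section \<open>Asymptotic direction of decaying solutions\<close>

text \<open>If the cosine exceeded -l at a late point, then G = f^2 - g^2 + l (f^2 + g^2) would be
  positive there and, because G' >= 2 k l G from then on, could not decay, although \<open>f\<close>
  and \<open>g\<close> do. Convergence of \<open>u\<close> to 0 at any rate is enough.\<close>

lemma zs_cos_at_top:
  fixes f g :: "real \<Rightarrow> real"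
  assumes z: "zs u k f g" and k: "k > 0" and f0: "(f \<longlongrightarrow> 0) at_top" and g0: "(g \<longlongrightarrow> 0) at_top"
    and u0: "(u \<longlongrightarrow> 0) at_top" and R: "\<And>x. (f x)\<^sup>2 + (g x)\<^sup>2 > 0"
  shows "((\<lambda>x. ((f x)\<^sup>2 - (g x)\<^sup>2) / ((f x)\<^sup>2 + (g x)\<^sup>2)) \<longlongrightarrow> -1) at_top"
proof -
  have fd: "\<And>x. (f has_real_derivative k * f x + u x * g x) (at x)"
    and gd: "\<And>x. (g has_real_derivative - k * g x - u x * f x) (at x)"
    using z unfolding zs_real_iff by auto
  have ev: "eventually (\<lambda>x. (f x)\<^sup>2 - (g x)\<^sup>2 \<le> - l * ((f x)\<^sup>2 + (g x)\<^sup>2)) at_top"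
    if l: "0 < l" "l < 1" for l
  proof -
    \<comment> \<open>The threshold for |u| comes from G' - 2 k l G = 2 k (1 - l^2) (f^2 + g^2) + 4
      u f g together with |2 f g| <= f^2 + g^2.\<close>
    have "k * (1 - l\<^sup>2) > 0" using k l by (simp add: abs_square_less_1)
    then have "eventually (\<lambda>x. \<bar>u x\<bar> < k * (1 - l\<^sup>2)) at_top"
      using u0 by (simp add: tendsto_iff dist_real_def)
    then obtain X where X: "\<And>x. x \<ge> X \<Longrightarrow> \<bar>u x\<bar> < k * (1 - l\<^sup>2)"
      by (auto simp: eventually_at_top_linorder)
    define G where "G = (\<lambda>x. (f x)\<^sup>2 - (g x)\<^sup>2 + l * ((f x)\<^sup>2 + (g x)\<^sup>2))"
    have G0: "(G \<longlongrightarrow> 0) at_top"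
      unfolding G_def by (rule tendsto_eq_intros f0 g0 | simp)+
    have "G a \<le> 0" if a: "a \<ge> X" for a
    proof (rule ccontr)
      assume "\<not> G a \<le> 0"
      then have Ga: "G a > 0" by simp
      have "G x \<ge> G a" if x: "a \<le> x" for x
      proof -
        have "G a * exp (- 2 * k * l * a) \<le> G x * exp (- 2 * k * l * x)"
        proof (rule DERIV_nonneg_imp_nondecreasing[OF x])
          fix y assume y: "a \<le> y" "y \<le> x"
          define D where "D = 2 * k * ((f y)\<^sup>2 + (g y)\<^sup>2) + 4 * u y * f y * g y
              + l * (2 * k * ((f y)\<^sup>2 - (g y)\<^sup>2))"
          have "((\<lambda>x. G x * exp (- 2 * k * l * x)) has_real_derivative
            (D - 2 * k * l * G y) * exp (- 2 * k * l * y)) (at y)"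
            unfolding G_def D_def
            by (auto intro!: derivative_eq_intros fd gd simp: algebra_simps power2_eq_square)
          moreover have "D - 2 * k * l * G y \<ge> 0"
          proof -
            have "\<bar>4 * u y * f y * g y\<bar> = 2 * \<bar>u y\<bar> * \<bar>2 * f y * g y\<bar>"
              by (simp add: abs_mult)
            also have "\<dots> \<le> 2 * (k * (1 - l\<^sup>2)) * ((f y)\<^sup>2 + (g y)\<^sup>2)"
            proof (rule mult_mono)
              show "2 * \<bar>u y\<bar> \<le> 2 * (k * (1 - l\<^sup>2))" using X[of y] a y by simp
              show "\<bar>2 * f y * g y\<bar> \<le> (f y)\<^sup>2 + (g y)\<^sup>2"
                using sum_squares_bound[of "\<bar>f y\<bar>" "\<bar>g y\<bar>"] by (simp add: abs_mult)
            qed (use \<open>k * (1 - l\<^sup>2) > 0\<close> in auto)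
            finally have "\<bar>4 * u y * f y * g y\<bar> \<le> 2 * (k * (1 - l\<^sup>2)) * ((f y)\<^sup>2 + (g y)\<^sup>2)" .
            then show ?thesis
              unfolding D_def G_def by (simp add: algebra_simps power2_eq_square abs_le_iff)
          qed
          ultimately show "\<exists>z. ((\<lambda>x. G x * exp (- 2 * k * l * x)) has_real_derivative z) (at y) \<and> 0 \<le> z"
            by (metis exp_ge_zero mult_nonneg_nonneg)
        qed
        then have "G a * exp (2 * k * l * (x - a)) \<le> G x"
          by (simp add: exp_minus exp_diff field_simps)
        moreover have "G a * 1 \<le> G a * exp (2 * k * l * (x - a))"
          using Ga k l x by (intro mult_left_mono) auto
        ultimately show ?thesis by simp
      qed
      then have "eventually (\<lambda>x. G a \<le> G x) at_top"
        by (auto simp: eventually_at_top_linorder)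
      from tendsto_le[OF _ G0 tendsto_const this] Ga show False by simp
    qed
    then show ?thesis
      unfolding eventually_at_top_linorder G_def by (intro exI[of _ X]) (auto simp: algebra_simps)
  qed
  show ?thesis
  proof (rule order_tendstoI)
    fix y :: real assume y: "y < -1"
    have "y < ((f x)\<^sup>2 - (g x)\<^sup>2) / ((f x)\<^sup>2 + (g x)\<^sup>2)" for x
    proof -
      have "-1 \<le> ((f x)\<^sup>2 - (g x)\<^sup>2) / ((f x)\<^sup>2 + (g x)\<^sup>2)"
        using R[of x] by (simp add: le_divide_eq)
      with y show ?thesis by simp
    qed
    then show "eventually (\<lambda>x. y < ((f x)\<^sup>2 - (g x)\<^sup>2) / ((f x)\<^sup>2 + (g x)\<^sup>2)) at_top"
      by simp
  next
    fix y :: real assume y: "y > -1"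
    \<comment> \<open>The midpoint of 1 and max 0 (-y): it lies strictly between 0 and 1 and
      satisfies -l < y, also when y >= 0.\<close>
    define l where "l = (1 + max 0 (- y)) / 2"
    have l: "0 < l" "l < 1" "- l < y" using y by (auto simp: l_def max_def field_simps)
    show "eventually (\<lambda>x. ((f x)\<^sup>2 - (g x)\<^sup>2) / ((f x)\<^sup>2 + (g x)\<^sup>2) < y) at_top"
      using ev[OF l(1,2)]
    proof eventually_elim
      case (elim x)
      then have "((f x)\<^sup>2 - (g x)\<^sup>2) / ((f x)\<^sup>2 + (g x)\<^sup>2) \<le> - l"
        using R[of x] by (simp add: divide_le_eq)
      with l show ?case by simp
    qed
  qed
qed

text \<open>The reflection x -> -x exchanges \<open>f\<close> and \<open>g\<close>, which reverses
  the sign of the cosine and carries this end to the other one.\<close>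

lemma zs_cos_at_bot:
  fixes f g :: "real \<Rightarrow> real"
  assumes z: "zs u k f g" and k: "k > 0" and f0: "(f \<longlongrightarrow> 0) at_bot" and g0: "(g \<longlongrightarrow> 0) at_bot"
    and u0: "(u \<longlongrightarrow> 0) at_bot" and R: "\<And>x. (f x)\<^sup>2 + (g x)\<^sup>2 > 0"
  shows "((\<lambda>x. ((f x)\<^sup>2 - (g x)\<^sup>2) / ((f x)\<^sup>2 + (g x)\<^sup>2)) \<longlongrightarrow> 1) at_bot"
proof -
  have "((\<lambda>x. ((g (-x))\<^sup>2 - (f (-x))\<^sup>2) / ((g (-x))\<^sup>2 + (f (-x))\<^sup>2)) \<longlongrightarrow> -1) at_top"
    using f0 g0 u0 R
    by (intro zs_cos_at_top[OF zs_reflect[OF z] k]) (simp_all add: filterlim_at_bot_mirror add.commute)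
  moreover have "- ((b - a) / (b + a)) = (a - b) / (a + b)" for a b :: real
    by (simp add: minus_divide_left add.commute)
  ultimately show ?thesis
    unfolding filterlim_at_bot_mirror using tendsto_minus by fastforce
qed

subsection \<open>Darboux transformation and trace inequality\<close>

text \<open>With \<open>c = cos \<alpha>\<close>, \<open>s = sin \<alpha>\<close> for the polar angle \<open>\<alpha> / 2\<close> of \<open>(f, g)\<close>, the matrix
  \<open>Q = (c, s; s, -c)\<close> is the reflection fixing \<open>(f, g)\<close>, and \<open>\<chi> \<mapsto> (l - k Q) \<chi>\<close> intertwines the
  systems at energy \<open>l\<close> with potentials \<open>u\<close> and \<open>u + 2 k s\<close>.\<close>

definition zs_cos :: "(real \<Rightarrow> real) \<Rightarrow> (real \<Rightarrow> real) \<Rightarrow> real \<Rightarrow> real" where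
  "zs_cos f g x = ((f x)\<^sup>2 - (g x)\<^sup>2) / ((f x)\<^sup>2 + (g x)\<^sup>2)"

definition zs_sin :: "(real \<Rightarrow> real) \<Rightarrow> (real \<Rightarrow> real) \<Rightarrow> real \<Rightarrow> real" where
  "zs_sin f g x = 2 * f x * g x / ((f x)\<^sup>2 + (g x)\<^sup>2)"

lemma zs_cos_sin:
  assumes "(f x)\<^sup>2 + (g x)\<^sup>2 > 0"
  shows "(zs_cos f g x)\<^sup>2 + (zs_sin f g x)\<^sup>2 = 1"
proof -
  have "((f x)\<^sup>2 - (g x)\<^sup>2)\<^sup>2 + (2 * f x * g x)\<^sup>2 = ((f x)\<^sup>2 + (g x)\<^sup>2)\<^sup>2"
    by algebra
  then show ?thesis
    using assms
    by (simp add: zs_cos_def zs_sin_def power_divide sum_power2_gt_zero_iff flip: add_divide_distrib)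
qed

text \<open>Together with the formula for \<open>zs_sin\<close> this says that the angle solves the
  scalar equation \<alpha>' = -(2 u + 2 k sin \<alpha>).\<close>

lemma zs_cos_deriv:
  fixes f g :: "real \<Rightarrow> real"
  assumes z: "zs u k f g" and R: "(f x)\<^sup>2 + (g x)\<^sup>2 > 0"
  shows "(zs_cos f g has_real_derivative (2 * u x + 2 * k * zs_sin f g x) * zs_sin f g x) (at x)"
proof -
  have fd: "(f has_real_derivative k * f x + u x * g x) (at x)"
    and gd: "(g has_real_derivative - k * g x - u x * f x) (at x)"
    using z unfolding zs_real_iff by auto
  define R where "R = (f x)\<^sup>2 + (g x)\<^sup>2"
  have R0: "R \<noteq> 0" using R unfolding R_def by linarith
  have "(zs_cos f g has_real_derivative
     ((2 * k * R + 4 * u x * f x * g x) * R - ((f x)\<^sup>2 - (g x)\<^sup>2) * (2 * k * ((f x)\<^sup>2 - (g x)\<^sup>2))) / (R * R)) (at x)"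
    unfolding zs_cos_def[abs_def] R_def
    using R0[unfolded R_def]
    by (auto intro!: derivative_eq_intros fd gd simp: algebra_simps power2_eq_square)
  moreover have "((2 * k * R + 4 * u x * f x * g x) * R - ((f x)\<^sup>2 - (g x)\<^sup>2) * (2 * k * ((f x)\<^sup>2 - (g x)\<^sup>2))) / (R * R)
    = (2 * u x + 2 * k * zs_sin f g x) * zs_sin f g x"
  proof -
    \<comment> \<open>Rests on (f^2 + g^2)^2 - (f^2 - g^2)^2 = (2 f g)^2.\<close>
    have e: "(2 * k * R + 4 * u x * f x * g x) * R - ((f x)\<^sup>2 - (g x)\<^sup>2) * (2 * k * ((f x)\<^sup>2 - (g x)\<^sup>2))
      = (2 * u x * R + 2 * k * (2 * f x * g x)) * (2 * f x * g x)"
      unfolding R_def by algebra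
    show ?thesis
      unfolding e zs_sin_def R_def[symmetric] using R0 by (simp add: field_simps)
  qed
  ultimately show ?thesis by simp
qed

lemma zs_sin_deriv:
  fixes f g :: "real \<Rightarrow> real"
  assumes z: "zs u k f g" and R: "(f x)\<^sup>2 + (g x)\<^sup>2 > 0"
  shows "(zs_sin f g has_real_derivative - (2 * u x + 2 * k * zs_sin f g x) * zs_cos f g x) (at x)"
proof -
  have fd: "(f has_real_derivative k * f x + u x * g x) (at x)"
    and gd: "(g has_real_derivative - k * g x - u x * f x) (at x)"
    using z unfolding zs_real_iff by auto
  define R where "R = (f x)\<^sup>2 + (g x)\<^sup>2"
  have R0: "R \<noteq> 0" using R unfolding R_def by linarith
  have "(zs_sin f g has_real_derivative
     (2 * u x * ((g x)\<^sup>2 - (f x)\<^sup>2) * R - (2 * f x * g x) * (2 * k * ((f x)\<^sup>2 - (g x)\<^sup>2))) / (R * R)) (at x)"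
    unfolding zs_sin_def[abs_def] R_def
    using R0[unfolded R_def]
    by (auto intro!: derivative_eq_intros fd gd simp: algebra_simps power2_eq_square)
  moreover have "(2 * u x * ((g x)\<^sup>2 - (f x)\<^sup>2) * R - (2 * f x * g x) * (2 * k * ((f x)\<^sup>2 - (g x)\<^sup>2))) / (R * R)
    = - (2 * u x + 2 * k * zs_sin f g x) * zs_cos f g x"
    unfolding zs_sin_def zs_cos_def R_def[symmetric] using R0 by (simp add: field_simps)
  ultimately show ?thesis by simp
qed

text \<open>Write the system as chi' = (l J + u E) chi with J = diag(1, -1) and E = (0, 1; -1, 0).
  Comparing powers of l in the intertwining relation for l - k Q, the linear terms read (v - u) E =
  k (J Q - Q J) = 2 k s E, which dictates the new potential v. The constant terms read Q' = (u + v)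
  E Q, which is what the derivatives of \<open>zs_cos\<close> and \<open>zs_sin\<close> say.\<close>

lemma zs_darboux:
  fixes f g p q :: "real \<Rightarrow> real"
  assumes z: "zs u k f g" and R: "\<And>x. (f x)\<^sup>2 + (g x)\<^sup>2 > 0" and zl: "zs u l p q"
  defines "c \<equiv> zs_cos f g" and "s \<equiv> zs_sin f g"
  shows "zs (\<lambda>x. u x + 2 * k * s x) l
    (\<lambda>x. l * p x - k * (c x * p x + s x * q x)) (\<lambda>x. l * q x - k * (s x * p x - c x * q x))"
  unfolding zs_real_iff
proof (intro allI conjI)
  fix x
  have d: "(p has_real_derivative l * p x + u x * q x) (at x)"
      "(q has_real_derivative - l * q x - u x * p x) (at x)"
      "(c has_real_derivative (2 * u x + 2 * k * s x) * s x) (at x)"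
      "(s has_real_derivative - (2 * u x + 2 * k * s x) * c x) (at x)"
    using zl zs_cos_deriv[OF z R] zs_sin_deriv[OF z R] unfolding zs_real_iff c_def s_def by auto
  have cs: "(c x)\<^sup>2 = 1 - (s x)\<^sup>2" using zs_cos_sin[of f x g, OF R] by (simp add: c_def s_def)
  have cs': "c x * (c x * a) = (1 - (s x)\<^sup>2) * a" for a
    using cs by (simp add: power2_eq_square flip: mult.assoc)
  show "((\<lambda>x. l * p x - k * (c x * p x + s x * q x)) has_real_derivative
      l * (l * p x - k * (c x * p x + s x * q x)) +
      (u x + 2 * k * s x) * (l * q x - k * (s x * p x - c x * q x))) (at x)"
    by (rule derivative_eq_intros d refl | simp)+ (simp add: algebra_simps power2_eq_square)
  show "((\<lambda>x. l * q x - k * (s x * p x - c x * q x)) has_real_derivative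
      - l * (l * q x - k * (s x * p x - c x * q x)) -
      (u x + 2 * k * s x) * (l * p x - k * (c x * p x + s x * q x))) (at x)"
    by (rule derivative_eq_intros d refl | simp)+ (simp add: algebra_simps power2_eq_square)
qed

text \<open>\<open>Q\<close> preserves the norm pointwise, so l - k Q can kill a nonzero vector only
  if l^2 = k^2; hence the image stays nonzero. It still tends to 0 because the entries of
  \<open>Q\<close> are bounded by 1.\<close>

lemma bound_state_darboux:
  fixes f g p q :: "real \<Rightarrow> real"
  assumes b: "bound_state u k f g" and bl: "bound_state u l p q" and kl: "l\<^sup>2 \<noteq> k\<^sup>2"
  shows "\<exists>p' q' :: real \<Rightarrow> real. bound_state (\<lambda>x. u x + 2 * k * zs_sin f g x) l p' q'"
proof -
  define c s where "c = zs_cos f g" and "s = zs_sin f g"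
  have R: "(f x)\<^sup>2 + (g x)\<^sup>2 > 0" for x by (rule bound_state_pos[OF b])
  have cs: "(c x)\<^sup>2 + (s x)\<^sup>2 = 1" for x
    using zs_cos_sin[of f x g, OF R] by (simp add: c_def s_def)
  have "\<bar>c x\<bar> \<le> 1" "\<bar>s x\<bar> \<le> 1" for x
    using cs[of x] zero_le_power2[of "c x"] zero_le_power2[of "s x"] unfolding abs_square_le_1[symmetric]
    by linarith+
  then have B: "Bfun c at_infinity" "Bfun s at_infinity"
    by (auto intro!: BfunI[of _ 1])
  have p0: "(p \<longlongrightarrow> 0) at_infinity" and q0: "(q \<longlongrightarrow> 0) at_infinity"
    using bl by (auto simp: bound_state_def)
  have t: "((\<lambda>x. a x * h x) \<longlongrightarrow> 0) at_infinity"
    if "Bfun a at_infinity" "(h \<longlongrightarrow> 0) at_infinity" for a h :: "real \<Rightarrow> real"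
    using bounded_bilinear.Bfun_prod_Zfun[OF bounded_bilinear_mult that(1)] that(2)
    by (simp add: tendsto_Zfun_iff)
  obtain a where a: "p a \<noteq> 0 \<or> q a \<noteq> 0" using bl by (auto simp: bound_state_def)
  define p' q' where "p' = (\<lambda>x. l * p x - k * (c x * p x + s x * q x))"
    and "q' = (\<lambda>x. l * q x - k * (s x * p x - c x * q x))"
  have "p' a \<noteq> 0 \<or> q' a \<noteq> 0"
  proof (rule ccontr)
    assume "\<not> ?thesis"
    then have "p' a = 0" "q' a = 0" by auto
    then have e: "l * p a = k * (c a * p a + s a * q a)" "l * q a = k * (s a * p a - c a * q a)"
      by (auto simp: p'_def q'_def)
    have "l\<^sup>2 * ((p a)\<^sup>2 + (q a)\<^sup>2) = (l * p a)\<^sup>2 + (l * q a)\<^sup>2" by algebra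
    also have "\<dots> = k\<^sup>2 * ((c a)\<^sup>2 + (s a)\<^sup>2) * ((p a)\<^sup>2 + (q a)\<^sup>2)"
      unfolding e by algebra
    finally show False using cs[of a] kl a by (auto simp: sum_power2_eq_zero_iff)
  qed
  moreover have "(p' \<longlongrightarrow> 0) at_infinity" "(q' \<longlongrightarrow> 0) at_infinity"
    unfolding p'_def q'_def
    by (rule tendsto_eq_intros t[OF B(1) p0] t[OF B(2) p0] t[OF B(1) q0] t[OF B(2) q0] p0 q0 | simp)+
  moreover have "zs (\<lambda>x. u x + 2 * k * s x) l p' q'"
    using b bl zs_darboux[of u k f g l p q, OF _ R]
    unfolding bound_state_def c_def s_def p'_def q'_def by blast
  ultimately show ?thesis
    unfolding bound_state_def s_def by blast
qed

lemma bound_state_cos_limits: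
  fixes f g :: "real \<Rightarrow> real"
  assumes b: "bound_state u k f g" and k: "k > 0" and u: "(u \<longlongrightarrow> 0) at_infinity"
  shows "(zs_cos f g \<longlongrightarrow> -1) at_top" "(zs_cos f g \<longlongrightarrow> 1) at_bot"
proof -
  have le: "at_top \<le> (at_infinity :: real filter)" "at_bot \<le> (at_infinity :: real filter)"
    by (simp_all add: at_infinity_eq_at_top_bot)
  have "(f \<longlongrightarrow> 0) at_infinity" "(g \<longlongrightarrow> 0) at_infinity" and z: "zs u k f g"
    using b by (auto simp: bound_state_def)
  then show "(zs_cos f g \<longlongrightarrow> -1) at_top" "(zs_cos f g \<longlongrightarrow> 1) at_bot"
    unfolding zs_cos_def[abs_def]
    using zs_cos_at_top[OF z k] zs_cos_at_bot[OF z k] bound_state_pos[OF b] tendsto_mono[OF le(1)]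
      tendsto_mono[OF le(2)] u
    by blast+
qed

text \<open>One bound state is removed per induction step. Both \<open>u\<close> and
  \<open>e\<close> vary in the induction: the remaining states belong to the transformed potential,
  and half of the error is spent on the boundary term.\<close>

lemma trace_inequality:
  fixes S :: "real set" and u :: "real \<Rightarrow> real"
  assumes "finite S" "\<And>k. k \<in> S \<Longrightarrow> k > 0"
    and "continuous_on UNIV u" "(u \<longlongrightarrow> 0) at_infinity"
    and "\<And>k. k \<in> S \<Longrightarrow> \<exists>f g :: real \<Rightarrow> real. bound_state u k f g" and "e > 0"
  shows "eventually (\<lambda>b. integral {-b..b} (\<lambda>x. (u x)\<^sup>2) \<ge> 4 * (\<Sum>k\<in>S. k) - e) at_top"
  using assms
proof (induction S arbitrary: u e rule: finite_induct)
  case empty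
  \<comment> \<open>A non-integrable function has integral 0 by convention, so the integral of a
    square is nonnegative in either case.\<close>
  have "integral {-b..b} (\<lambda>x. (u x)\<^sup>2) \<ge> 4 * (\<Sum>k\<in>{}. k) - e" for b
    using integral_nonneg[of "\<lambda>x. (u x)\<^sup>2" "{-b..b}"] empty
    by (smt (verit) not_integrable_integral sum.empty zero_le_power2)
  then show ?case by simp
next
  case (insert k S)
  have k: "k > 0" using insert.prems by simp
  obtain f g :: "real \<Rightarrow> real" where b: "bound_state u k f g"
    using insert.prems(4)[of k] by auto
  have z: "zs u k f g" using b by (simp add: bound_state_def)
  define c s where "c = zs_cos f g" and "s = zs_sin f g"
  define v where "v = (\<lambda>x. u x + 2 * k * s x)"
  have R: "(f x)\<^sup>2 + (g x)\<^sup>2 > 0" for x by (rule bound_state_pos[OF b])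
  have cs: "(c x)\<^sup>2 + (s x)\<^sup>2 = 1" for x
    using zs_cos_sin[of f x g, OF R] by (simp add: c_def s_def)
  have cd: "(c has_real_derivative (2 * u x + 2 * k * s x) * s x) (at x)" for x
    unfolding c_def s_def by (rule zs_cos_deriv[OF z R])
  have sd: "(s has_real_derivative - (2 * u x + 2 * k * s x) * c x) (at x)" for x
    unfolding c_def s_def by (rule zs_sin_deriv[OF z R])
  have cl: "(c \<longlongrightarrow> -1) at_top" "(c \<longlongrightarrow> 1) at_bot"
    unfolding c_def by (rule bound_state_cos_limits[OF b k insert.prems(3)])+
  \<comment> \<open>Here |s| = sqrt (1 - c^2), and c^2 tends to 1 at both ends.\<close>
  have s0: "(s \<longlongrightarrow> 0) at_infinity"
  proof -
    have "((\<lambda>x. sqrt (1 - (c x)\<^sup>2)) \<longlongrightarrow> 0) at_infinity"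
      unfolding at_infinity_eq_at_top_bot
      by (rule filterlim_sup) (rule tendsto_eq_intros cl | simp)+
    moreover have "sqrt (1 - (c x)\<^sup>2) = \<bar>s x\<bar>" for x
      using cs[of x] by (metis add_diff_cancel_left' real_sqrt_abs)
    ultimately show ?thesis by (simp add: tendsto_rabs_zero_iff)
  qed
  have sc: "continuous_on UNIV s"
    using sd by (auto intro!: DERIV_continuous_on)
  have vc: "continuous_on UNIV v"
    unfolding v_def by (intro continuous_intros insert.prems sc)
  have "eventually (\<lambda>b. integral {-b..b} (\<lambda>x. (v x)\<^sup>2) \<ge> 4 * (\<Sum>k\<in>S. k) - e / 2) at_top"
  proof (rule insert.IH)
    show "(v \<longlongrightarrow> 0) at_infinity"
      unfolding v_def by (rule tendsto_eq_intros s0 insert.prems | simp)+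
    show "\<exists>f g :: real \<Rightarrow> real. bound_state v l f g" if l: "l \<in> S" for l
    proof -
      have "l > 0" "l \<noteq> k" using insert l by auto
      then have "l\<^sup>2 \<noteq> k\<^sup>2" using k by (simp add: power2_eq_iff)
      moreover obtain p q :: "real \<Rightarrow> real" where "bound_state u l p q"
        using insert.prems(4)[of l] l by auto
      ultimately show ?thesis
        using bound_state_darboux[OF b] unfolding v_def s_def by blast
    qed
  qed (use insert vc in auto)
  \<comment> \<open>The error e / (4 k) becomes e / 2 after multiplication by 2 k, the other half
    being left to the induction hypothesis.\<close>
  moreover have "eventually (\<lambda>b. c (-b) - c b > 2 - e / (4 * k)) at_top"
  proof -
    have "((\<lambda>b. c (-b) - c b) \<longlongrightarrow> 2) at_top"
      using cl by (auto intro!: tendsto_eq_intros simp: filterlim_at_bot_mirror)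
    then show ?thesis
      using k \<open>e > 0\<close> by (intro order_tendstoD(1)) auto
  qed
  ultimately show ?case
    using eventually_ge_at_top[of 0]
  proof eventually_elim
    case (elim b)
    \<comment> \<open>The difference of squares is -2 k (2 u + 2 k s) s = -2 k c', an exact
      derivative.\<close>
    have "((\<lambda>x. (u x)\<^sup>2 - (v x)\<^sup>2) has_integral (- 2 * k * c b) - (- 2 * k * c (-b))) {-b..b}"
    proof (rule fundamental_theorem_of_calculus)
      fix x
      have "((\<lambda>x. - 2 * k * c x) has_real_derivative (u x)\<^sup>2 - (v x)\<^sup>2) (at x)"
        by (auto intro!: derivative_eq_intros cd simp: v_def algebra_simps power2_eq_square)
      then show "((\<lambda>x. - 2 * k * c x) has_vector_derivative (u x)\<^sup>2 - (v x)\<^sup>2) (at x within {-b..b})"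
        by (simp add: has_real_derivative_iff_has_vector_derivative has_vector_derivative_at_within)
    qed (use elim in auto)
    then have "integral {-b..b} (\<lambda>x. (u x)\<^sup>2 - (v x)\<^sup>2) = 2 * k * (c (-b) - c b)"
      by (simp add: integral_unique algebra_simps)
    moreover have "integral {-b..b} (\<lambda>x. (u x)\<^sup>2 - (v x)\<^sup>2) =
        integral {-b..b} (\<lambda>x. (u x)\<^sup>2) - integral {-b..b} (\<lambda>x. (v x)\<^sup>2)"
      by (intro integral_diff integrable_continuous_interval continuous_intros
          continuous_on_subset[OF vc] continuous_on_subset[OF insert.prems(2)]) auto
    moreover have "2 * k * (c (-b) - c b) \<ge> 2 * k * (2 - e / (4 * k))"
      using elim k by (intro mult_left_mono) auto
    moreover have "2 * k * (2 - e / (4 * k)) = 4 * k - e / 2"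
      using k by (simp add: field_simps)
    ultimately show ?case
      using elim insert by simp
  qed
qed

subsection \<open>Completeness of the trigonometric system\<close>

definition annihilates_trig :: "(real \<Rightarrow> complex) \<Rightarrow> bool" where
  "annihilates_trig w \<longleftrightarrow> continuous_on {0..2*pi} w \<and>
    (\<forall>n::int. integral {0..2*pi} (\<lambda>y. w y * cis (n * y)) = 0)"

lemma annihilates_trig_lincomb:
  assumes "annihilates_trig v" "annihilates_trig w"
  shows "annihilates_trig (\<lambda>y. a * v y + b * w y)"
proof -
  have c: "continuous_on {0..2*pi} v" "continuous_on {0..2*pi} w"
    using assms by (auto simp: annihilates_trig_def)
  have "integral {0..2*pi} (\<lambda>y. (a * v y + b * w y) * cis (of_int n * y)) = 0" for n :: int
  proof -
    have "integral {0..2*pi} (\<lambda>y. (a * v y + b * w y) * cis (of_int n * y)) =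
      integral {0..2*pi} (\<lambda>y. a * (v y * cis (of_int n * y)) + b * (w y * cis (of_int n * y)))"
      by (simp add: algebra_simps)
    also have "\<dots> = integral {0..2*pi} (\<lambda>y. a * (v y * cis (of_int n * y))) +
        integral {0..2*pi} (\<lambda>y. b * (w y * cis (of_int n * y)))"
      by (intro integral_add integrable_continuous_interval continuous_intros c)
    also have "\<dots> = 0"
      using assms by (simp add: annihilates_trig_def)
    finally show ?thesis .
  qed
  then show ?thesis
    unfolding annihilates_trig_def by (auto intro!: continuous_intros c)
qed

lemma annihilates_trig_cis:
  assumes "annihilates_trig w"
  shows "annihilates_trig (\<lambda>y. w y * cis (of_int m * y))"
  using assms unfolding annihilates_trig_def
  by (auto intro!: continuous_intros simp: mult.assoc cis_mult simp flip: distrib_right of_int_add)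

text \<open>Orthogonality to all e^(iny) survives multiplication by e^(iy) and e^(-iy), hence by cos
  and sin, which generate the polynomials on the circle. A product is handled as two successive
  multiplications, so \<open>w\<close> has to vary in the induction.\<close>

lemma annihilates_trig_polynomial:
  fixes p :: "complex \<Rightarrow> real"
  assumes "real_polynomial_function p"
  shows "annihilates_trig w \<Longrightarrow> annihilates_trig (\<lambda>y. w y * of_real (p (cis y)))"
  using assms
proof (induction arbitrary: w rule: real_polynomial_function.induct)
  case (linear f)
  interpret bounded_linear f by fact
  have "f (cis y) = cos y * f 1 + sin y * f \<i>" for y
  proof -
    have "cis y = cos y *\<^sub>R 1 + sin y *\<^sub>R \<i>" by (simp add: complex_eq_iff)
    then show ?thesis by (simp only: add scaleR) simp
  qed
  then have e: "complex_of_real (f (cis y)) =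
      (of_real (f 1) - \<i> * of_real (f \<i>)) / 2 * cis (of_int 1 * y) +
      (of_real (f 1) + \<i> * of_real (f \<i>)) / 2 * cis (of_int (-1) * y)" for y
    by (simp add: complex_eq_iff field_simps)
  show ?case
    unfolding e
    using annihilates_trig_lincomb[OF annihilates_trig_cis[OF linear.prems, of 1] annihilates_trig_cis[OF linear.prems, of "-1"],
        of "(of_real (f 1) - \<i> * of_real (f \<i>)) / 2" "(of_real (f 1) + \<i> * of_real (f \<i>)) / 2"]
    by (simp add: algebra_simps)
next
  case (const c)
  then show ?case
    using annihilates_trig_lincomb[OF const const, of "of_real c" 0] by (simp add: mult.commute)
next
  case (add f g)
  then show ?case
    using annihilates_trig_lincomb[OF add.IH(1) add.IH(2), of w w 1 1] by (simp add: algebra_simps)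
next
  case (mult f g)
  then show ?case
    using mult.IH(2)[OF mult.IH(1)[OF mult.prems]] by (simp add: algebra_simps)
qed

text \<open>Approximate \<open>a\<close>, seen as a function on the circle, by a polynomial p up to
  e. As \<open>a\<close> is orthogonal to p, the integral of a^2 equals that of a (a - p), which is
  at most e times the integral of |a|.\<close>

lemma annihilates_trig_real_imp_0:
  fixes a :: "real \<Rightarrow> real"
  assumes ann: "annihilates_trig (\<lambda>y. of_real (a y))" and per: "a (2 * pi) = a 0" and y: "y \<in> {0..2*pi}"
  shows "a y = 0"
proof -
  have ca: "continuous_on {0..2*pi} a"
    using continuous_on_Re[of "{0..2*pi}" "\<lambda>y. complex_of_real (a y)"] ann
    by (simp add: annihilates_trig_def)
  \<comment> \<open>\<open>Arg2pi\<close> takes values in [0, 2 pi), so at the point 1 of the circle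
    \<open>A\<close> reads off \<open>a 0\<close>; \<open>per\<close> makes this agree with the
    right endpoint.\<close>
  define A where "A = (\<lambda>z. a (Arg2pi z))"
  have cis_im: "cis ` {0..2*pi} = sphere 0 1"
  proof (intro equalityI subsetI)
    fix z :: complex assume "z \<in> sphere 0 1"
    then have "z = cis (Arg2pi z)" using Arg2pi_eq[of z] by (simp add: cis_conv_exp)
    then show "z \<in> cis ` {0..2*pi}"
      using Arg2pi_ge_0[of z] Arg2pi_lt_2pi[of z] by (intro image_eqI[of _ _ "Arg2pi z"]) auto
  qed auto
  have A: "A (cis y) = a y" if "y \<in> {0..2*pi}" for y
  proof (cases "y = 2 * pi")
    case True
    have "Arg2pi 1 = 0" by (rule Arg2pi_unique[of 1]) auto
    then show ?thesis using True per by (simp add: A_def)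
  next
    case False
    then have "Arg2pi (cis y) = y"
      using that by (intro Arg2pi_unique[of 1]) (auto simp: cis_conv_exp)
    then show ?thesis by (simp add: A_def)
  qed
  \<comment> \<open>\<open>Arg2pi\<close> itself jumps at 1, so continuity is obtained by descent:
    \<open>cis\<close> maps the compact interval onto the circle and is therefore a quotient
    map.\<close>
  have cA: "continuous_on (sphere 0 1) A"
  proof (subst continuous_on_open, intro allI impI)
    fix V assume V: "openin (top_of_set (A ` sphere 0 1)) V"
    have im: "A ` sphere 0 1 = a ` {0..2*pi}"
      unfolding cis_im[symmetric] image_image using A by (intro image_cong) auto
    have "openin (top_of_set {0..2*pi}) ({0..2*pi} \<inter> a -` V)"
      using ca V unfolding continuous_on_open im by blast
    moreover have "{0..2*pi} \<inter> a -` V = {0..2*pi} \<inter> cis -` (sphere 0 1 \<inter> A -` V)"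
      using A cis_im by auto
    moreover have "continuous_on {0..2*pi} cis"
      by (intro continuous_intros)
    ultimately show "openin (top_of_set (sphere 0 1)) (sphere 0 1 \<inter> A -` V)"
      using Abstract_Topology_2.continuous_imp_quotient_map[of "{0..2*pi}" cis "sphere 0 1" "sphere 0 1 \<inter> A -` V"]
        cis_im by simp
  qed
  have ia: "(\<lambda>y. (a y)\<^sup>2) integrable_on {0..2*pi}" "(\<lambda>y. \<bar>a y\<bar>) integrable_on {0..2*pi}"
    by (intro integrable_continuous_interval continuous_intros ca)+
  have small: "integral {0..2*pi} (\<lambda>y. (a y)\<^sup>2) \<le> e * integral {0..2*pi} (\<lambda>y. \<bar>a y\<bar>)" if e: "e > 0" for e
  proof -
    obtain p where p: "real_polynomial_function p" "\<And>z. z \<in> sphere 0 1 \<Longrightarrow> \<bar>A z - p z\<bar> < e"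
      using Stone_Weierstrass_real_polynomial_function[OF compact_sphere cA e] by blast
    have cp: "continuous_on {0..2*pi} (\<lambda>y. p (cis y))"
      using p(1) unfolding real_polynomial_function_eq
      by (intro continuous_on_compose2[OF continuous_on_polymonial_function[of p UNIV]] continuous_intros) auto
    have "integral {0..2*pi} (\<lambda>y. complex_of_real (a y * p (cis y))) = 0"
      using annihilates_trig_polynomial[OF p(1) ann] unfolding annihilates_trig_def
      by (auto dest!: spec[of _ 0])
    moreover have "(\<lambda>y. a y * p (cis y)) integrable_on {0..2*pi}"
      by (intro integrable_continuous_interval continuous_intros ca cp)
    ultimately have "integral {0..2*pi} (\<lambda>y. a y * p (cis y)) = 0"
      using integral_linear[OF _ bounded_linear_of_real[where 'a=complex]] unfolding o_def
      by (metis of_real_eq_0_iff)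
    then have "integral {0..2*pi} (\<lambda>y. (a y)\<^sup>2) = integral {0..2*pi} (\<lambda>y. (a y)\<^sup>2 - a y * p (cis y))"
      by (subst integral_diff) (auto intro!: integrable_continuous_interval continuous_intros ca cp)
    also have "\<dots> \<le> integral {0..2*pi} (\<lambda>y. e * \<bar>a y\<bar>)"
    proof (rule integral_le)
      fix y assume y: "y \<in> {0..2*pi}"
      have "(a y)\<^sup>2 - a y * p (cis y) = a y * (a y - p (cis y))" by (simp add: algebra_simps power2_eq_square)
      also have "\<dots> \<le> \<bar>a y\<bar> * \<bar>a y - p (cis y)\<bar>" by (metis abs_ge_self abs_mult)
      also have "\<dots> \<le> \<bar>a y\<bar> * e"
        using p(2)[of "cis y"] A[OF y] by (intro mult_left_mono) auto
      finally show "(a y)\<^sup>2 - a y * p (cis y) \<le> e * \<bar>a y\<bar>" by (simp add: mult.commute)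
    qed (intro integrable_continuous_interval continuous_intros ca cp)+
    finally show ?thesis by simp
  qed
  have "integral {0..2*pi} (\<lambda>y. (a y)\<^sup>2) \<le> 0"
  proof (rule field_le_epsilon)
    fix e :: real assume e: "e > 0"
    define I where "I = integral {0..2*pi} (\<lambda>y. \<bar>a y\<bar>)"
    have I: "I \<ge> 0" unfolding I_def by (intro integral_nonneg ia) auto
    \<comment> \<open>Dividing by \<open>I + 1\<close> covers the case \<open>I = 0\<close>.\<close>
    have "integral {0..2*pi} (\<lambda>y. (a y)\<^sup>2) \<le> e / (I + 1) * I"
      unfolding I_def using e I by (intro small) (auto simp: I_def)
    also have "\<dots> \<le> e" using I e by (simp add: field_simps)
    finally show "integral {0..2*pi} (\<lambda>y. (a y)\<^sup>2) \<le> 0 + e" by simp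
  qed
  then have "integral {0..2*pi} (\<lambda>y. (a y)\<^sup>2) = 0"
    using integral_nonneg[OF ia(1)] by simp
  then have "\<forall>y\<in>{0..2*pi}. (a y)\<^sup>2 = 0"
    using integral_eq_0_iff[of 0 "2*pi" "\<lambda>y. (a y)\<^sup>2"] ca by (simp add: continuous_intros)
  then show ?thesis using y by simp
qed

text \<open>Conjugation turns the condition for n into the one for -n, so real and imaginary parts
  satisfy the condition separately.\<close>

lemma annihilates_trig_imp_0:
  assumes ann: "annihilates_trig w" and per: "w (2 * pi) = w 0" and y: "y \<in> {0..2*pi}"
  shows "w y = 0"
proof -
  have cw: "continuous_on {0..2*pi} w" using ann by (simp add: annihilates_trig_def)
  have "annihilates_trig (\<lambda>y. cnj (w y))"
    unfolding annihilates_trig_def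
  proof (intro conjI allI)
    fix n :: int
    have "integral {0..2*pi} (\<lambda>y. cnj (w y * cis (of_int (- n) * y))) = 0"
      using ann unfolding annihilates_trig_def integral_cnj[symmetric] by (metis complex_cnj_zero)
    then show "integral {0..2*pi} (\<lambda>y. cnj (w y) * cis (of_int n * y)) = 0"
      by (simp add: cis_cnj)
  qed (intro continuous_intros cw)
  from annihilates_trig_lincomb[OF ann this, of "1/2" "1/2"]
    annihilates_trig_lincomb[OF ann this, of "- \<i>/2" "\<i>/2"]
  moreover have "1/2 * z + 1/2 * cnj z = of_real (Re z)" "- \<i>/2 * z + \<i>/2 * cnj z = of_real (Im z)" for z
    by (simp_all add: complex_eq_iff)
  ultimately have "annihilates_trig (\<lambda>y. of_real (Re (w y)))" "annihilates_trig (\<lambda>y. of_real (Im (w y)))"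
    by (simp_all only:)
  from annihilates_trig_real_imp_0[OF this(1) _ y] annihilates_trig_real_imp_0[OF this(2) _ y] per
  show ?thesis by (simp add: complex_eq_iff)
qed

section \<open>Fourier coefficients of antiperiodic functions\<close>

text \<open>Antiperiodic functions expand in e^(i(n+1/2)y); \<open>n\<close> indexes the
  half-integer n + 1/2. The factor 1 / (2 pi) is left out here and restored in
  \<open>fourier_half_finite\<close>.\<close>

definition fourier_half :: "int \<Rightarrow> (real \<Rightarrow> complex) \<Rightarrow> complex" where
  "fourier_half n w = integral {0..2*pi} (\<lambda>y. w y * cis (- (n + 1/2) * y))"

lemma has_vector_derivative_cis_mult:
  "((\<lambda>y. cis (a * y)) has_vector_derivative \<i> * a * cis (a * y)) (at y within S)"
proof -
  have "((\<lambda>y. exp (y *\<^sub>R (\<i> * a))) has_vector_derivative exp (y *\<^sub>R (\<i> * a)) * (\<i> * a)) (at y within S)"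
    by (rule exp_scaleR_has_vector_derivative_right)
  then show ?thesis
    by (simp add: cis_conv_exp scaleR_conv_of_real mult_ac)
qed

lemma continuous_on_cis_mult [continuous_intros]:
  "continuous_on S (\<lambda>y. cis (a * y))" for a :: real
  by (intro continuous_intros)

lemma integral_cis_int:
  fixes m :: int
  shows "integral {0..2*pi} (\<lambda>y. cis (m * y)) = (if m = 0 then 2 * pi else 0)"
proof (cases "m = 0")
  case False
  have "((\<lambda>y. cis (m * y)) has_integral cis (m * (2 * pi)) / (\<i> * m) - cis (real_of_int m * 0) / (\<i> * m)) {0..2*pi}"
  proof (rule fundamental_theorem_of_calculus[where f = "\<lambda>y. cis (m * y) / (\<i> * m)"])
    fix y :: real
    show "((\<lambda>y. cis (m * y) / (\<i> * m)) has_vector_derivative cis (m * y)) (at y within {0..2*pi})"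
      using has_vector_derivative_divide[OF has_vector_derivative_cis_mult[of m y], of "\<i> * m"] False
      by simp
  qed simp
  moreover have "cis (m * (2 * pi)) = 1"
    using cis_multiple_2pi[of "real_of_int m"] by (simp add: mult_ac)
  ultimately show ?thesis using False by (simp add: integral_unique)
qed (simp add: scaleR_conv_of_real)

lemma fourier_half_lincomb:
  assumes "continuous_on UNIV v" "continuous_on UNIV w"
  shows "fourier_half n (\<lambda>y. a * v y + b * w y) = a * fourier_half n v + b * fourier_half n w"
proof -
  have c: "continuous_on {0..2*pi} v" "continuous_on {0..2*pi} w"
    using assms continuous_on_subset by blast+
  have "fourier_half n (\<lambda>y. a * v y + b * w y) =
    integral {0..2*pi} (\<lambda>y. a * (v y * cis (- (n + 1/2) * y)) + b * (w y * cis (- (n + 1/2) * y)))"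
    by (simp add: fourier_half_def algebra_simps)
  also have "\<dots> = integral {0..2*pi} (\<lambda>y. a * (v y * cis (- (n + 1/2) * y))) +
      integral {0..2*pi} (\<lambda>y. b * (w y * cis (- (n + 1/2) * y)))"
    by (intro integral_add integrable_continuous_interval continuous_intros c)
  finally show ?thesis by (simp add: fourier_half_def)
qed

lemma fourier_half_sum:
  assumes "finite A" "\<And>i. i \<in> A \<Longrightarrow> continuous_on UNIV (w i)"
  shows "fourier_half n (\<lambda>y. \<Sum>i\<in>A. w i y) = (\<Sum>i\<in>A. fourier_half n (w i))"
  using assms
proof (induction A rule: finite_induct)
  case (insert i A)
  have "continuous_on UNIV (\<lambda>y. \<Sum>i\<in>A. w i y)"
    using insert by (intro continuous_intros) auto
  then show ?case
    using insert fourier_half_lincomb[of "w i" "\<lambda>y. \<Sum>i\<in>A. w i y" n 1 1] by simp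
qed (simp add: fourier_half_def)

lemma fourier_half_cis:
  "fourier_half n (\<lambda>y. a * cis ((m + 1/2) * y)) = (if n = m then 2 * pi * a else 0)" for m n :: int and a :: complex
proof -
  have "fourier_half n (\<lambda>y. a * cis ((m + 1/2) * y)) = integral {0..2*pi} (\<lambda>y. a * cis (of_int (m - n) * y))"
    unfolding fourier_half_def mult.assoc cis_mult by (simp add: algebra_simps)
  then show ?thesis by (simp only: integral_mult_right integral_cis_int) auto
qed

lemma cis_half_2pi: "cis ((m + 1/2) * (2 * pi)) = -1" for m :: int
proof -
  have "(m + 1/2) * (2 * pi) = 2 * pi * of_int m + pi" by (simp add: algebra_simps)
  then show ?thesis by (simp flip: cis_mult)
qed

text \<open>Integration by parts: \<open>w\<close> and the exponential both change sign over a
  period, so their product takes equal values at the endpoints and the boundary term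
  vanishes.\<close>

lemma fourier_half_deriv:
  assumes d: "\<And>y. (w has_vector_derivative w' y) (at y)" and c: "continuous_on UNIV w'"
    and per: "w (2 * pi) = - w 0"
  shows "fourier_half n w' = \<i> * of_real (n + 1/2) * fourier_half n w"
proof -
  have cw: "continuous_on {0..2*pi} w" "continuous_on {0..2*pi} w'"
    using has_vector_derivative_continuous[OF d] continuous_on_subset[OF c]
    by (auto intro!: continuous_at_imp_continuous_on)
  have cis1: "cis (- (n + 1/2) * (2 * pi)) = -1"
    using cis_half_2pi[of n] by (metis cis_cnj complex_cnj_minus complex_cnj_one mult_minus_left)
  have "((\<lambda>y. w y * (\<i> * complex_of_real (- (n + 1/2)) * cis (- (n + 1/2) * y)) + w' y * cis (- (n + 1/2) * y))
     has_integral w (2*pi) * cis (- (n + 1/2) * (2*pi)) - w 0 * cis (- (n + 1/2) * 0)) {0..2*pi}"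
    by (rule fundamental_theorem_of_calculus)
      (simp, intro has_vector_derivative_mult has_vector_derivative_cis_mult
        has_vector_derivative_at_within[OF d])
  then have "0 = integral {0..2*pi} (\<lambda>y. w y * (\<i> * complex_of_real (- (n + 1/2)) * cis (- (n + 1/2) * y)) + w' y * cis (- (n + 1/2) * y))"
    unfolding cis1 per by (simp add: integral_unique)
  also have "\<dots> = integral {0..2*pi} (\<lambda>y. (\<i> * complex_of_real (- (n + 1/2))) * (w y * cis (- (n + 1/2) * y)) + w' y * cis (- (n + 1/2) * y))"
    by (simp add: mult_ac)
  also have "\<dots> = integral {0..2*pi} (\<lambda>y. (\<i> * complex_of_real (- (n + 1/2))) * (w y * cis (- (n + 1/2) * y))) +
       integral {0..2*pi} (\<lambda>y. w' y * cis (- (n + 1/2) * y))"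
    by (intro integral_add integrable_continuous_interval continuous_intros cw)
  also have "\<dots> = \<i> * complex_of_real (- (n + 1/2)) * fourier_half n w + fourier_half n w'"
    by (simp only: integral_mult_right fourier_half_def)
  finally show ?thesis by (simp add: algebra_simps)
qed

text \<open>The factor e^(-iy/2) makes \<open>w\<close> periodic and shifts half-integer frequencies
  to integers, so completeness applies on one period; antiperiodicity carries the zeros to the whole
  line.\<close>

lemma fourier_half_imp_0:
  assumes c: "continuous_on UNIV w" and per: "\<And>y. w (y + 2 * pi) = - w y"
    and 0: "\<And>n. fourier_half n w = 0"
  shows "w y = 0"
proof -
  have cw: "continuous_on {0..2*pi} w" using c continuous_on_subset by blast
  have "annihilates_trig (\<lambda>y. w y * cis (- (1/2) * y))"
    unfolding annihilates_trig_def
  proof (intro conjI allI continuous_intros cw)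
    fix n :: int
    have "integral {0..2*pi} (\<lambda>y. w y * cis (- (1/2) * y) * cis (of_int n * y)) = fourier_half (- n) w"
      unfolding fourier_half_def mult.assoc cis_mult by (simp add: algebra_simps)
    then show "integral {0..2*pi} (\<lambda>y. w y * cis (- (1/2) * y) * cis (of_int n * y)) = 0"
      by (simp add: 0)
  qed
  moreover have "w (2 * pi) * cis (- (1/2) * (2 * pi)) = w 0 * cis (- (1/2) * 0)"
    using per[of 0] by (simp add: complex_eq_iff)
  ultimately have z: "w y = 0" if "y \<in> {0..2*pi}" for y
    using annihilates_trig_imp_0[of "\<lambda>y. w y * cis (- (1/2) * y)" y] that
    by (simp only: mult_eq_0_iff cis_neq_zero simp_thms)
  have "w (z + 2 * pi * of_int m) = 0 \<longleftrightarrow> w z = 0" for m z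
  proof (induction m rule: int_induct[where k = 0])
    case (step1 i)
    then show ?case using per[of "z + 2 * pi * of_int i"] by (simp add: algebra_simps)
  next
    case (step2 i)
    then show ?case using per[of "z + 2 * pi * of_int (i - 1)"] by (simp add: algebra_simps)
  qed simp
  from this[of "y - 2 * pi * of_int \<lfloor>y / (2 * pi)\<rfloor>" "\<lfloor>y / (2 * pi)\<rfloor>"]
  have "w y = 0 \<longleftrightarrow> w (y - 2 * pi * of_int \<lfloor>y / (2 * pi)\<rfloor>) = 0"
    by simp
  moreover have "w (y - 2 * pi * of_int \<lfloor>y / (2 * pi)\<rfloor>) = 0"
  proof (rule z)
    show "y - 2 * pi * of_int \<lfloor>y / (2 * pi)\<rfloor> \<in> {0..2*pi}"
      using floor_divide_lower[of "2 * pi" y] floor_divide_upper[of "2 * pi" y] by (simp add: algebra_simps)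
  qed
  ultimately show ?thesis by simp
qed

subsection \<open>Fourier modes of the Dirac kernel\<close>

definition mode :: "int \<Rightarrow> (real \<times> real \<Rightarrow> complex) \<Rightarrow> real \<Rightarrow> complex" where
  "mode n h x = fourier_half n (\<lambda>y. h (x, y))"

lemma C1_spinor_continuous:
  assumes "C1_spinor \<psi>"
  shows "continuous_on UNIV (\<lambda>q. \<psi> q $ i)"
proof -
  have "continuous_on UNIV \<psi>"
    using assms unfolding C1_spinor_def
    by (blast intro: continuous_at_imp_continuous_on has_derivative_continuous)
  then show ?thesis by (intro continuous_intros)
qed

text \<open>The partial derivatives are the total derivative applied to the coordinate vectors.
  Their continuity serves both differentiation under the integral and the continuity of
  \<open>U\<close>.\<close>

lemma C1_spinor_continuous_partials:
  assumes "C1_spinor \<psi>"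
  shows "continuous_on UNIV (partial_x (\<lambda>q. \<psi> q $ i))" "continuous_on UNIV (partial_y (\<lambda>q. \<psi> q $ i))"
proof -
  from assms obtain \<psi>' where d: "\<And>p. (\<psi> has_derivative blinfun_apply (\<psi>' p)) (at p)"
      and c: "continuous_on UNIV \<psi>'"
    unfolding C1_spinor_def by blast
  have di: "((\<lambda>q. \<psi> q $ i) has_derivative (\<lambda>h. blinfun_apply (\<psi>' p) h $ i)) (at p)" for p
    by (rule bounded_linear.has_derivative[OF bounded_linear_vec_nth d])
  have "partial_x (\<lambda>q. \<psi> q $ i) = (\<lambda>p. blinfun_apply (\<psi>' p) (1, 0) $ i)"
  proof
    fix p :: "real \<times> real"
    have s: "((\<lambda>s. (s, snd p)) has_derivative (\<lambda>h. (h, 0))) (at (fst p))"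
      by (intro has_derivative_Pair has_derivative_ident has_derivative_const)
    have "((\<lambda>s. \<psi> (s, snd p) $ i) has_derivative (\<lambda>h. blinfun_apply (\<psi>' p) (h, 0) $ i)) (at (fst p))"
      using has_derivative_compose[OF s, of "\<lambda>q. \<psi> q $ i"] di[of p] by (simp only: prod.collapse)
    moreover have "(\<lambda>h. blinfun_apply (\<psi>' p) (h, 0) $ i) = (\<lambda>h. h *\<^sub>R (blinfun_apply (\<psi>' p) (1, 0) $ i))"
    proof
      fix h
      have "(h, 0 :: real) = h *\<^sub>R (1, 0)" by simp
      then show "blinfun_apply (\<psi>' p) (h, 0) $ i = h *\<^sub>R (blinfun_apply (\<psi>' p) (1, 0) $ i)"
        by (simp only: blinfun.scaleR_right vector_scaleR_component)
    qed
    ultimately have "((\<lambda>s. \<psi> (s, snd p) $ i) has_vector_derivative blinfun_apply (\<psi>' p) (1, 0) $ i) (at (fst p))"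
      unfolding has_vector_derivative_def by (rule has_derivative_eq_rhs)
    then show "partial_x (\<lambda>q. \<psi> q $ i) p = blinfun_apply (\<psi>' p) (1, 0) $ i"
      by (rule partial_eqI)
  qed
  moreover have "partial_y (\<lambda>q. \<psi> q $ i) = (\<lambda>p. blinfun_apply (\<psi>' p) (0, 1) $ i)"
  proof
    fix p :: "real \<times> real"
    have s: "((\<lambda>s. (fst p, s)) has_derivative (\<lambda>h. (0, h))) (at (snd p))"
      by (intro has_derivative_Pair has_derivative_ident has_derivative_const)
    have "((\<lambda>s. \<psi> (fst p, s) $ i) has_derivative (\<lambda>h. blinfun_apply (\<psi>' p) (0, h) $ i)) (at (snd p))"
      using has_derivative_compose[OF s, of "\<lambda>q. \<psi> q $ i"] di[of p] by (simp only: prod.collapse)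
    moreover have "(\<lambda>h. blinfun_apply (\<psi>' p) (0, h) $ i) = (\<lambda>h. h *\<^sub>R (blinfun_apply (\<psi>' p) (0, 1) $ i))"
    proof
      fix h
      have "(0 :: real, h) = h *\<^sub>R (0, 1)" by simp
      then show "blinfun_apply (\<psi>' p) (0, h) $ i = h *\<^sub>R (blinfun_apply (\<psi>' p) (0, 1) $ i)"
        by (simp only: blinfun.scaleR_right vector_scaleR_component)
    qed
    ultimately have "((\<lambda>s. \<psi> (fst p, s) $ i) has_vector_derivative blinfun_apply (\<psi>' p) (0, 1) $ i) (at (snd p))"
      unfolding has_vector_derivative_def by (rule has_derivative_eq_rhs)
    then show "partial_y (\<lambda>q. \<psi> q $ i) p = blinfun_apply (\<psi>' p) (0, 1) $ i"
      by (rule partial_eqI)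
  qed
  moreover have "continuous_on UNIV (\<lambda>p. blinfun_apply (\<psi>' p) v $ i)" for v
    by (rule bounded_linear.continuous_on[OF bounded_linear_vec_nth
          bounded_linear.continuous_on[OF blinfun.bounded_linear_left c]])
  ultimately show "continuous_on UNIV (partial_x (\<lambda>q. \<psi> q $ i))" "continuous_on UNIV (partial_y (\<lambda>q. \<psi> q $ i))"
    by simp_all
qed

lemma continuous_on_slice:
  fixes h :: "real \<times> real \<Rightarrow> 'a::topological_space"
  assumes "continuous_on UNIV h"
  shows "continuous_on S (\<lambda>y. h (x, y))"
  by (rule continuous_on_compose2[OF assms]) (auto intro!: continuous_intros)

lemma continuous_on_mode:
  assumes "continuous_on UNIV h"
  shows "continuous_on UNIV (mode n h)"
proof -
  have "continuous_on UNIV (\<lambda>x. integral (cbox 0 (2*pi)) (\<lambda>y. h (x, y) * cis (- (n + 1/2) * y)))"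
  proof (rule integral_continuous_on_param)
    have "continuous_on (UNIV \<times> cbox 0 (2*pi)) h"
      using assms by (rule continuous_on_subset) simp
    then show "continuous_on (UNIV \<times> cbox 0 (2*pi)) (\<lambda>(x, y). h (x, y) * cis (- (n + 1/2) * y))"
      unfolding case_prod_unfold prod.collapse by (intro continuous_intros)
  qed
  then show ?thesis by (simp add: mode_def[abs_def] fourier_half_def)
qed

text \<open>The relation is required on the slice at \<open>x\<close> only, so the coefficients
  \<open>a\<close> and \<open>b\<close> may depend on \<open>x\<close>, as \<open>U x\<close>
  does.\<close>

lemma mode_lincomb:
  assumes "continuous_on UNIV v" "continuous_on UNIV w" "\<And>y. h (x, y) = a * v (x, y) + b * w (x, y)"
  shows "mode n h x = a * mode n v x + b * mode n w x"
  unfolding mode_def assms(3) by (intro fourier_half_lincomb continuous_on_slice assms)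

lemma mode_deriv_x:
  assumes "C1_spinor \<psi>"
  shows "(mode n (\<lambda>q. \<psi> q $ i) has_vector_derivative mode n (partial_x (\<lambda>q. \<psi> q $ i)) x) (at x)"
proof -
  let ?e = "\<lambda>y. cis (- (n + 1/2) * y)"
  have "((\<lambda>x. integral (cbox 0 (2*pi)) (\<lambda>y. \<psi> (x, y) $ i * ?e y)) has_vector_derivative
      integral (cbox 0 (2*pi)) (\<lambda>y. partial_x (\<lambda>q. \<psi> q $ i) (x, y) * ?e y)) (at x within UNIV)"
  proof (rule leibniz_rule_vector_derivative)
    fix x y
    show "((\<lambda>x. \<psi> (x, y) $ i * ?e y) has_vector_derivative partial_x (\<lambda>q. \<psi> q $ i) (x, y) * ?e y) (at x within UNIV)"
      by (intro has_vector_derivative_mult_left C1_spinor_has_partials(1) assms)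
  next
    fix x
    show "(\<lambda>y. \<psi> (x, y) $ i * ?e y) integrable_on cbox 0 (2*pi)"
      by (intro integrable_continuous continuous_on_mult continuous_on_cis_mult
          continuous_on_slice[OF C1_spinor_continuous[OF assms]])
  next
    show "continuous_on (UNIV \<times> cbox 0 (2*pi)) (\<lambda>(x, y). partial_x (\<lambda>q. \<psi> q $ i) (x, y) * ?e y)"
    proof -
      have "continuous_on (UNIV \<times> cbox 0 (2*pi)) (partial_x (\<lambda>q. \<psi> q $ i))"
        using C1_spinor_continuous_partials(1)[OF assms, of i] by (rule continuous_on_subset) simp
      then show ?thesis
        unfolding case_prod_unfold prod.collapse by (intro continuous_intros)
    qed
  qed auto
  then show ?thesis by (simp add: mode_def[abs_def] fourier_half_def)
qed

lemma mode_deriv_y: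
  assumes "C1_spinor \<psi>" "\<And>x y. \<psi> (x, y + 2 * pi) = - \<psi> (x, y)"
  shows "mode n (partial_y (\<lambda>q. \<psi> q $ i)) x = \<i> * of_real (n + 1/2) * mode n (\<lambda>q. \<psi> q $ i) x"
  unfolding mode_def
  using assms(2)[of x 0]
  by (intro fourier_half_deriv C1_spinor_has_partials(2) continuous_on_slice
      C1_spinor_continuous_partials(2) assms(1)) simp

lemma dirac_ker_equations:
  assumes "\<psi> \<in> dirac_ker (\<lambda>(x, y). U x)"
  shows "partial_x (\<lambda>q. \<psi> q $ 1) (x, y) = - \<i> * partial_y (\<lambda>q. \<psi> q $ 1) (x, y) + of_real (2 * U x) * \<psi> (x, y) $ 2"
    "partial_x (\<lambda>q. \<psi> q $ 2) (x, y) = \<i> * partial_y (\<lambda>q. \<psi> q $ 2) (x, y) + of_real (- 2 * U x) * \<psi> (x, y) $ 1"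
proof -
  have "dirac (\<lambda>(x, y). U x) \<psi> (x, y) = 0" using assms unfolding dirac_ker_def by blast
  then have w: "wirtinger (\<lambda>q. \<psi> q $ 2) (x, y) + of_real (U x) * (\<psi> (x, y) $ 1) = 0"
     "- wirtinger_bar (\<lambda>q. \<psi> q $ 1) (x, y) + of_real (U x) * (\<psi> (x, y) $ 2) = 0"
    by (simp_all add: dirac_def vec_eq_iff forall_2)
  have h: "a = b - 2 * c" if "(a - b) / 2 + c = 0" for a b c :: complex
  proof -
    have "a - b + 2 * c = 2 * ((a - b) / 2 + c)" by simp
    then show ?thesis using that by (simp add: diff_eq_eq add_eq_0_iff2)
  qed
  show "partial_x (\<lambda>q. \<psi> q $ 2) (x, y) = \<i> * partial_y (\<lambda>q. \<psi> q $ 2) (x, y) + of_real (- 2 * U x) * \<psi> (x, y) $ 1"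
    using h[OF w(1)[unfolded wirtinger_def]] by simp
  have "(partial_x (\<lambda>q. \<psi> q $ 1) (x, y) - (- \<i> * partial_y (\<lambda>q. \<psi> q $ 1) (x, y))) / 2
      + - of_real (U x) * (\<psi> (x, y) $ 2) = 0"
    using w(2) by (simp add: wirtinger_bar_def add_eq_0_iff)
  from h[OF this]
  show "partial_x (\<lambda>q. \<psi> q $ 1) (x, y) = - \<i> * partial_y (\<lambda>q. \<psi> q $ 1) (x, y) + of_real (2 * U x) * \<psi> (x, y) $ 2"
    by simp
qed

lemma dirac_ker_D:
  assumes "\<psi> \<in> dirac_ker V"
  shows "C1_spinor \<psi>" "\<psi> (x, y + 2 * pi) = - \<psi> (x, y)"
  using assms by (auto simp: dirac_ker_def)

lemma mode_partial_x:
  assumes k: "\<psi> \<in> dirac_ker (\<lambda>(x, y). U x)"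
  shows "mode n (partial_x (\<lambda>q. \<psi> q $ 1)) x =
      of_real (n + 1/2) * mode n (\<lambda>q. \<psi> q $ 1) x + of_real (2 * U x) * mode n (\<lambda>q. \<psi> q $ 2) x"
    "mode n (partial_x (\<lambda>q. \<psi> q $ 2)) x =
      - of_real (n + 1/2) * mode n (\<lambda>q. \<psi> q $ 2) x - of_real (2 * U x) * mode n (\<lambda>q. \<psi> q $ 1) x"
proof -
  note c = C1_spinor_continuous_partials(2)[OF dirac_ker_D(1)[OF k]] C1_spinor_continuous[OF dirac_ker_D(1)[OF k]]
  note y = mode_deriv_y[OF dirac_ker_D[OF k]]
  have "\<i> * (\<i> * z) = - z" for z :: complex by (simp flip: mult.assoc)
  then show "mode n (partial_x (\<lambda>q. \<psi> q $ 1)) x =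
      of_real (n + 1/2) * mode n (\<lambda>q. \<psi> q $ 1) x + of_real (2 * U x) * mode n (\<lambda>q. \<psi> q $ 2) x"
    "mode n (partial_x (\<lambda>q. \<psi> q $ 2)) x =
      - of_real (n + 1/2) * mode n (\<lambda>q. \<psi> q $ 2) x - of_real (2 * U x) * mode n (\<lambda>q. \<psi> q $ 1) x"
    using mode_lincomb[OF c, of "partial_x (\<lambda>q. \<psi> q $ 1)" x, OF dirac_ker_equations(1)[OF k], of n]
      mode_lincomb[OF c, of "partial_x (\<lambda>q. \<psi> q $ 2)" x, OF dirac_ker_equations(2)[OF k], of n]
    unfolding y by (simp_all add: algebra_simps)
qed

lemma mode_zs:
  assumes k: "\<psi> \<in> dirac_ker (\<lambda>(x, y). U x)"
  shows "zs (\<lambda>x. 2 * U x) (n + 1/2) (mode n (\<lambda>q. \<psi> q $ 1)) (mode n (\<lambda>q. \<psi> q $ 2))"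
  using mode_deriv_x[OF dirac_ker_D(1)[OF k], of n 1] mode_deriv_x[OF dirac_ker_D(1)[OF k], of n 2]
  unfolding zs_def mode_partial_x[OF k] by (simp add: scaleR_conv_of_real)

lemma exp_minus_abs_tendsto_0: "((\<lambda>x::real. exp (- \<bar>x\<bar>)) \<longlongrightarrow> 0) at_infinity"
  using filterlim_norm_at_top[where 'a = real]
  by (intro filterlim_compose[OF exp_at_bot]) (simp add: filterlim_uminus_at_bot real_norm_def[abs_def])

text \<open>The decay condition is uniform in y, so it bounds the whole integrand on the slice by
  sqrt (C exp (-|x|)).\<close>

lemma mode_tendsto_0:
  assumes k: "\<psi> \<in> dirac_ker V"
  shows "(mode n (\<lambda>q. \<psi> q $ i) \<longlongrightarrow> 0) at_infinity"
proof -
  have "(\<lambda>p. (norm (\<psi> p))\<^sup>2) \<in> O[filtercomap fst at_infinity](\<lambda>p. exp (- \<bar>fst p\<bar>))"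
    using k by (simp add: dirac_ker_def)
  then obtain C where C: "C > 0" "eventually (\<lambda>p. norm ((norm (\<psi> p))\<^sup>2) \<le> C * norm (exp (- \<bar>fst p\<bar>))) (filtercomap fst at_infinity)"
    by (auto elim!: landau_o.bigE)
  then obtain Q where Q: "eventually Q at_infinity" "\<And>p. Q (fst p) \<Longrightarrow> (norm (\<psi> p))\<^sup>2 \<le> C * exp (- \<bar>fst p\<bar>)"
    by (auto simp: eventually_filtercomap)
  have t: "((\<lambda>x::real. sqrt (C * exp (- \<bar>x\<bar>)) * (2 * pi)) \<longlongrightarrow> 0) at_infinity"
  proof -
    have "((\<lambda>x::real. sqrt (C * exp (- \<bar>x\<bar>)) * (2 * pi)) \<longlongrightarrow> sqrt (C * 0) * (2 * pi)) at_infinity"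
      by (intro tendsto_intros exp_minus_abs_tendsto_0)
    then show ?thesis by simp
  qed
  show ?thesis
  proof (rule Lim_null_comparison[OF _ t])
    show "eventually (\<lambda>x. norm (mode n (\<lambda>q. \<psi> q $ i) x) \<le> sqrt (C * exp (- \<bar>x\<bar>)) * (2 * pi)) at_infinity"
      using Q(1)
    proof eventually_elim
      case (elim x)
      have "norm (integral {0..2*pi} (\<lambda>y. \<psi> (x, y) $ i * cis (- (n + 1/2) * y))) \<le> sqrt (C * exp (- \<bar>x\<bar>)) * (2 * pi - 0)"
      proof (rule integral_bound)
        show "continuous_on {0..2 * pi} (\<lambda>y. \<psi> (x, y) $ i * cis (- (n + 1/2) * y))"
          by (intro continuous_on_mult continuous_on_cis_mult
              continuous_on_slice[OF C1_spinor_continuous[OF dirac_ker_D(1)[OF k]]])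
        fix y
        show "norm (\<psi> (x, y) $ i * cis (- (n + 1/2) * y)) \<le> sqrt (C * exp (- \<bar>x\<bar>))"
        proof -
          have "norm (\<psi> (x, y) $ i) \<le> norm (\<psi> (x, y))" by (rule Finite_Cartesian_Product.norm_nth_le)
          also have "\<dots> \<le> sqrt (C * exp (- \<bar>x\<bar>))"
            using Q(2)[of "(x, y)"] elim by (intro real_le_rsqrt) simp
          finally show "norm (\<psi> (x, y) $ i * cis (- (n + 1/2) * y)) \<le> sqrt (C * exp (- \<bar>x\<bar>))"
            by (simp add: norm_mult)
        qed
      qed simp
      then show ?case by (simp add: mode_def fourier_half_def)
    qed
  qed
qed

lemma mode_imp_real_bound_state:
  assumes k: "\<psi> \<in> dirac_ker (\<lambda>(x, y). U x)"
    and nz: "mode n (\<lambda>q. \<psi> q $ 1) a \<noteq> 0 \<or> mode n (\<lambda>q. \<psi> q $ 2) a \<noteq> 0"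
  shows "\<exists>f g :: real \<Rightarrow> real. bound_state (\<lambda>x. 2 * U x) (n + 1/2) f g"
proof -
  let ?F = "mode n (\<lambda>q. \<psi> q $ 1)" and ?G = "mode n (\<lambda>q. \<psi> q $ 2)"
  have L: "bound_state (\<lambda>x. 2 * U x) (n + 1/2) (\<lambda>x. L (?F x)) (\<lambda>x. L (?G x))"
    if "bounded_linear L" "L (?F a) \<noteq> 0 \<or> L (?G a) \<noteq> 0" for L :: "complex \<Rightarrow> real"
    unfolding bound_state_def
  proof (intro conjI exI[of _ a])
    show "zs (\<lambda>x. 2 * U x) (n + 1/2) (\<lambda>x. L (?F x)) (\<lambda>x. L (?G x))"
      by (rule zs_bounded_linear[OF that(1) mode_zs[OF k]])
  qed (rule bounded_linear.tendsto_zero[OF that(1) mode_tendsto_0[OF k]] that(2))+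
  show ?thesis
    using L[OF bounded_linear_Re] L[OF bounded_linear_Im] nz by (metis complex_eq_iff zero_complex.sel)
qed

text \<open>With kappa = n + 1/2, the two equations combine to 2 U (|F|^2 + |G|^2) = (F' - kappa F)
  cnj G - (G' + kappa G) cnj F. By uniqueness the factor of \<open>U\<close> has no zero, and
  everything else is continuous.\<close>

lemma mode_imp_continuous:
  assumes k: "\<psi> \<in> dirac_ker (\<lambda>(x, y). U x)"
    and nz: "mode n (\<lambda>q. \<psi> q $ 1) a \<noteq> 0 \<or> mode n (\<lambda>q. \<psi> q $ 2) a \<noteq> 0"
  shows "continuous_on UNIV U"
proof -
  define F G where "F = mode n (\<lambda>q. \<psi> q $ 1)" and "G = mode n (\<lambda>q. \<psi> q $ 2)"
  define DF DG where "DF = mode n (partial_x (\<lambda>q. \<psi> q $ 1))" and "DG = mode n (partial_x (\<lambda>q. \<psi> q $ 2))"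
  note c1 = dirac_ker_D(1)[OF k]
  have c: "continuous_on UNIV F" "continuous_on UNIV G" "continuous_on UNIV DF" "continuous_on UNIV DG"
    unfolding F_def G_def DF_def DG_def
    by (rule continuous_on_mode, rule C1_spinor_continuous[OF c1] C1_spinor_continuous_partials[OF c1])+
  have e: "DF x = of_real (n + 1/2) * F x + of_real (2 * U x) * G x" "DG x = - of_real (n + 1/2) * G x - of_real (2 * U x) * F x" for x
    unfolding F_def G_def DF_def DG_def by (rule mode_partial_x[OF k])+
  have R: "(cmod (F x))\<^sup>2 + (cmod (G x))\<^sup>2 \<noteq> 0" for x
    using zs_complex_unique[OF mode_zs[OF k, of n], of x a] nz
    unfolding F_def[symmetric] G_def[symmetric] by (auto simp: sum_power2_eq_zero_iff)
  have nz: "2 * ((cmod (F x))\<^sup>2 + (cmod (G x))\<^sup>2) \<noteq> 0" for x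
    using R[of x] by (metis mult_eq_0_iff zero_neq_numeral)
  have "U x = Re ((DF x - of_real (n + 1/2) * F x) * cnj (G x) - (DG x + of_real (n + 1/2) * G x) * cnj (F x)) /
      (2 * ((cmod (F x))\<^sup>2 + (cmod (G x))\<^sup>2))" for x
  proof -
    have eq: "(DF x - of_real (n + 1/2) * F x) * cnj (G x) - (DG x + of_real (n + 1/2) * G x) * cnj (F x)
      = of_real (2 * U x * ((cmod (F x))\<^sup>2 + (cmod (G x))\<^sup>2))"
      unfolding e of_real_mult of_real_add complex_norm_square
      by (simp add: algebra_simps)
    show ?thesis
      unfolding eq Re_complex_of_real nonzero_eq_divide_eq[OF nz] by simp
  qed
  then have "U = (\<lambda>x. Re ((DF x - of_real (n + 1/2) * F x) * cnj (G x) - (DG x + of_real (n + 1/2) * G x) * cnj (F x)) /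
      (2 * ((cmod (F x))\<^sup>2 + (cmod (G x))\<^sup>2)))" by blast
  moreover have "continuous_on UNIV \<dots>"
    by (intro continuous_intros c) (use nz in blast)
  ultimately show ?thesis by simp
qed

text \<open>The difference from the trigonometric polynomial has no nonzero coefficient, so
  completeness makes it vanish; no convergence question arises.\<close>

lemma fourier_half_finite:
  assumes c: "continuous_on UNIV w" and per: "\<And>y. w (y + 2 * pi) = - w y"
    and K: "finite K" and 0: "\<And>n. n \<notin> K \<Longrightarrow> fourier_half n w = 0"
  shows "w y = (\<Sum>n\<in>K. fourier_half n w / (2 * pi) * cis ((n + 1/2) * y))"
proof -
  define t where "t = (\<lambda>y. \<Sum>n\<in>K. fourier_half n w / (2 * pi) * cis ((n + 1/2) * y))"
  have ct: "continuous_on UNIV t"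
    unfolding t_def by (intro continuous_intros)
  have "1 * w y + (-1) * t y = 0"
  proof (rule fourier_half_imp_0)
    show "continuous_on UNIV (\<lambda>y. 1 * w y + (-1) * t y)"
      by (intro continuous_intros c ct)
    fix y
    have "cis ((n + 1/2) * (y + 2 * pi)) = - cis ((n + 1/2) * y)" for n :: int
    proof -
      have "cis ((n + 1/2) * (y + 2 * pi)) = cis ((n + 1/2) * y) * cis ((n + 1/2) * (2 * pi))"
        by (simp add: cis_mult algebra_simps)
      then show ?thesis by (simp only: cis_half_2pi) simp
    qed
    then have "t (y + 2 * pi) = - t y"
      unfolding t_def by (simp add: sum_negf)
    then show "1 * w (y + 2 * pi) + (-1) * t (y + 2 * pi) = - (1 * w y + (-1) * t y)"
      using per[of y] by simp
  next
    fix m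
    have "fourier_half m t = (\<Sum>n\<in>K. fourier_half m (\<lambda>y. fourier_half n w / (2 * pi) * cis ((n + 1/2) * y)))"
      unfolding t_def by (intro fourier_half_sum K continuous_intros)
    also have "\<dots> = fourier_half m w"
      unfolding fourier_half_cis using 0[of m] K by (simp add: sum.delta')
    finally have "fourier_half m t = fourier_half m w" .
    then show "fourier_half m (\<lambda>y. 1 * w y + (-1) * t y) = 0"
      unfolding fourier_half_lincomb[OF c ct] by simp
  qed
  then show ?thesis by (simp add: t_def)
qed

section \<open>Dimension of the kernel against the number of eigenvalues\<close>

lemma bound_state_of_real:
  fixes f g :: "real \<Rightarrow> real"
  assumes "bound_state u k f g"
  shows "bound_state u k (\<lambda>x. complex_of_real (f x)) (\<lambda>x. complex_of_real (g x))"
  using assms zs_bounded_linear[OF bounded_linear_of_real[where 'a = complex], of u k f g]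
    tendsto_of_real[of f 0 at_infinity, where 'a = complex] tendsto_of_real[of g 0 at_infinity, where 'a = complex]
  unfolding bound_state_def by simp

text \<open>Each mode of a kernel element is a complex multiple of one fixed real bound state, and
  only modes in \<open>K\<close> occur, so the kernel lies in the span of the spinors
  \<open>e n\<close>. An upper bound asks for no more than this inclusion.\<close>

lemma dim_dirac_ker_le:
  assumes K: "finite K"
    and b: "\<And>n. n \<in> K \<Longrightarrow> \<exists>f g :: real \<Rightarrow> real. bound_state (\<lambda>x. 2 * U x) (of_int n + 1/2) f g"
    and out: "\<And>\<psi> n x. \<psi> \<in> dirac_ker (\<lambda>(x, y). U x) \<Longrightarrow> n \<notin> K \<Longrightarrow>
      mode n (\<lambda>q. \<psi> q $ 1) x = 0 \<and> mode n (\<lambda>q. \<psi> q $ 2) x = 0"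
  shows "spinor.dim (dirac_ker (\<lambda>(x, y). U x)) \<le> card K"
proof -
  obtain f g :: "int \<Rightarrow> real \<Rightarrow> real"
    where fg: "\<And>n. n \<in> K \<Longrightarrow> bound_state (\<lambda>x. 2 * U x) (of_int n + 1/2) (f n) (g n)"
    using b by metis
  define e :: "int \<Rightarrow> spinor" where "e = (\<lambda>n p. vector
      [of_real (f n (fst p)) * cis ((n + 1/2) * snd p), of_real (g n (fst p)) * cis ((n + 1/2) * snd p)])"
  have "dirac_ker (\<lambda>(x, y). U x) \<subseteq> spinor.span (e ` K)"
  proof
    fix \<psi> assume k: "\<psi> \<in> dirac_ker (\<lambda>(x, y). U x)"
    have "\<exists>c. \<forall>x. mode n (\<lambda>q. \<psi> q $ 1) x = c * of_real (f n x) \<and> mode n (\<lambda>q. \<psi> q $ 2) x = c * of_real (g n x)"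
      if "n \<in> K" for n
      by (rule bound_state_proportional[OF bound_state_of_real[OF fg[OF that]] mode_zs[OF k] mode_tendsto_0[OF k]
            mode_tendsto_0[OF k]])
    then obtain c where c: "\<And>n x. n \<in> K \<Longrightarrow> mode n (\<lambda>q. \<psi> q $ 1) x = c n * of_real (f n x)"
        "\<And>n x. n \<in> K \<Longrightarrow> mode n (\<lambda>q. \<psi> q $ 2) x = c n * of_real (g n x)"
      by metis
    have s: "(\<Sum>n\<in>A. F n) p $ i = (\<Sum>n\<in>A. F n p $ i)" if "finite A" for A :: "int set" and F :: "int \<Rightarrow> spinor" and p and i :: 2
      using that by (induction A rule: finite_induct) simp_all
    have x: "\<psi> (x, y) $ i = (\<Sum>n\<in>K. mode n (\<lambda>q. \<psi> q $ i) x / (2 * pi) * cis ((n + 1/2) * y))"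
      if o: "\<And>n. n \<notin> K \<Longrightarrow> mode n (\<lambda>q. \<psi> q $ i) x = 0" for x y i
      using fourier_half_finite[of "\<lambda>y. \<psi> (x, y) $ i" K y] dirac_ker_D[OF k] K o
        continuous_on_slice[OF C1_spinor_continuous[of \<psi> i]]
      by (simp add: mode_def)
    have "\<psi> p = (\<Sum>n\<in>K. spinor_scale (c n / (2 * pi)) (e n)) p" for p
    proof (cases p)
      case (Pair x y)
      show ?thesis
        unfolding vec_eq_iff forall_2 s[OF K] Pair
        using x[of 1 x y] x[of 2 x y] out[OF k] c
        by (simp add: spinor_scale_def e_def mult_ac)
    qed
    then have "\<psi> = (\<Sum>n\<in>K. spinor_scale (c n / (2 * pi)) (e n))" by blast
    moreover have "(\<Sum>n\<in>K. spinor_scale (c n / (2 * pi)) (e n)) \<in> spinor.span (e ` K)"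
      by (intro spinor.span_sum spinor.span_scale spinor.span_base imageI)
    ultimately show "\<psi> \<in> spinor.span (e ` K)" by simp
  qed
  then have "spinor.dim (dirac_ker (\<lambda>(x, y). U x)) \<le> card (e ` K)"
    using K by (intro spinor.dim_le_card) auto
  also have "\<dots> \<le> card K" by (rule card_image_le[OF K])
  finally show ?thesis .
qed

section \<open>Counting, integrability and conclusion\<close>

text \<open>Adding the largest element b to m smaller nonnegative ones forces b >= m, and m + 1/2 is
  exactly the increment of m^2 / 2.\<close>

lemma sum_half_integers_ge:
  fixes S :: "int set"
  assumes "finite S" "\<And>n. n \<in> S \<Longrightarrow> n \<ge> 0"
  shows "(\<Sum>n\<in>S. real_of_int n + 1/2) \<ge> (real (card S))\<^sup>2 / 2"
  using assms
proof (induction S rule: finite_linorder_max_induct)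
  case (insert b A)
  have "card A \<le> card {0..<b}"
    using insert by (intro card_mono) auto
  moreover have "b \<ge> 0" using insert by simp
  ultimately have "real (card A) \<le> b" by (simp add: le_nat_iff)
  moreover have "(\<Sum>n\<in>A. real_of_int n + 1/2) \<ge> (real (card A))\<^sup>2 / 2"
    using insert by simp
  moreover have "b \<notin> A" using insert by auto
  ultimately show ?case
    using insert by (simp add: power2_eq_square field_simps)
qed simp

lemma integrable_exp_minus_abs: "integrable lborel (\<lambda>x::real. exp (- \<bar>x\<bar>))"
proof -
  define f :: "real \<Rightarrow> real" where "f = (\<lambda>x. indicator {0..} x *\<^sub>R exp (- 1 * x))"
  have "integrable lebesgue f"
    unfolding f_def
    using nonnegative_absolutely_integrable_1[of "\<lambda>x::real. exp (- 1 * x)" "{0..}"]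
      integrable_on_exp_minus_to_infinity[of 1 0]
    unfolding set_integrable_def by (simp only: exp_ge_zero zero_less_one)
  moreover have "f \<in> borel_measurable lborel"
    unfolding f_def by measurable
  ultimately have f: "integrable lborel f"
    using integrable_completion[of f lborel] by simp
  \<comment> \<open>The sum dominates exp (-|x|) rather than equalling it, since both terms are 1 at
    the origin.\<close>
  then have "integrable lborel (\<lambda>x. f x + f (0 + (-1) * x))"
    by (intro Bochner_Integration.integrable_add lborel_integrable_real_affine) auto
  then show ?thesis
    by (rule Bochner_Integration.integrable_bound) (auto simp: f_def indicator_def)
qed

lemma square_integrable_bigo_exp:
  fixes U :: "real \<Rightarrow> real"
  assumes c: "continuous_on UNIV U" and O: "U \<in> O[at_infinity](\<lambda>x. exp (- \<bar>x\<bar>))"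
  shows "integrable lborel (\<lambda>x. (U x)\<^sup>2)"
proof -
  obtain C where C: "C > 0" "eventually (\<lambda>x. norm (U x) \<le> C * norm (exp (- \<bar>x\<bar>))) at_infinity"
    using O by (auto elim!: landau_o.bigE)
  then obtain X where X: "\<And>x. X \<le> \<bar>x\<bar> \<Longrightarrow> \<bar>U x\<bar> \<le> C * exp (- \<bar>x\<bar>)"
    by (auto simp: eventually_at_infinity)
  have "bounded (U ` {-X..X})"
    by (intro compact_imp_bounded compact_continuous_image continuous_on_subset[OF c]) auto
  then obtain B where "\<forall>y\<in>U ` {-X..X}. norm y \<le> B"
    unfolding bounded_iff by blast
  then have B: "\<And>x. \<bar>x\<bar> \<le> X \<Longrightarrow> \<bar>U x\<bar> \<le> B"
    by (auto simp: abs_le_iff)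
  \<comment> \<open>The term C^2 serves the tail, where exp (-2 |x|) <= exp (-|x|); the factor exp X
    compensates the weight on the compact core |x| < X.\<close>
  define M where "M = C\<^sup>2 + B\<^sup>2 * exp X"
  have "(U x)\<^sup>2 \<le> M * exp (- \<bar>x\<bar>)" for x
  proof (cases "X \<le> \<bar>x\<bar>")
    case True
    have "(U x)\<^sup>2 \<le> (C * exp (- \<bar>x\<bar>))\<^sup>2"
      using power_mono[OF X[OF True], of 2] by simp
    also have "\<dots> = C\<^sup>2 * (exp (- \<bar>x\<bar>) * exp (- \<bar>x\<bar>))"
      by (simp add: power2_eq_square)
    also have "\<dots> \<le> C\<^sup>2 * (exp (- \<bar>x\<bar>) * 1)"
      by (intro mult_left_mono) auto
    also have "\<dots> \<le> M * exp (- \<bar>x\<bar>)"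
      unfolding M_def by (simp add: distrib_right)
    finally show ?thesis .
  next
    case False
    then have "\<bar>U x\<bar> \<le> B" using B by simp
    then have "(U x)\<^sup>2 \<le> B\<^sup>2 * 1"
      using power_mono[of "\<bar>U x\<bar>" B 2] by simp
    also have "\<dots> \<le> B\<^sup>2 * (exp X * exp (- \<bar>x\<bar>))"
      using False by (intro mult_left_mono) (auto simp flip: exp_add)
    also have "\<dots> \<le> M * exp (- \<bar>x\<bar>)"
      unfolding M_def by (simp add: distrib_right)
    finally show ?thesis .
  qed
  then have "norm ((U x)\<^sup>2) \<le> norm (M * exp (- \<bar>x\<bar>))" for x
    unfolding real_norm_def abs_power2 by (rule order_trans[OF _ abs_ge_self])
  then have n: "AE x in lborel. norm ((U x)\<^sup>2) \<le> norm (M * exp (- \<bar>x\<bar>))"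
    by (rule AE_I2)
  have m: "(\<lambda>x. (U x)\<^sup>2) \<in> borel_measurable lborel"
    unfolding measurable_lborel2 by (intro borel_measurable_continuous_onI continuous_on_power c)
  have "integrable lborel (\<lambda>x. M * exp (- \<bar>x\<bar>))"
    using integrable_exp_minus_abs by (rule integrable_mult_right)
  from Bochner_Integration.integrable_bound[OF this m n] show ?thesis .
qed

theorem theorem7:
  fixes U :: "real \<Rightarrow> real" and N :: nat
  assumes "U \<in> O[at_infinity](\<lambda>x. exp (- \<bar>x\<bar>))"
    and "dim_H (dirac_ker (\<lambda>(x, y). U x)) \<ge> real N"
  shows "(LBINT x. (U x)\<^sup>2) \<ge> (real N)\<^sup>2 / 2"
proof (cases "N = 0")
  case True
  then show ?thesis by simp
next
  case False
  have dim: "2 * N \<le> spinor.dim (dirac_ker (\<lambda>(x, y). U x))"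
    using assms(2) by (simp add: dim_H_def)
  define u where "u = (\<lambda>x. 2 * U x)"
  \<comment> \<open>If \<open>U\<close> were discontinuous, every mode of every kernel element would
    vanish, and the kernel would have dimension 0.\<close>
  have cU: "continuous_on UNIV U"
  proof (rule ccontr)
    assume "\<not> ?thesis"
    then have "spinor.dim (dirac_ker (\<lambda>(x, y). U x)) \<le> card ({} :: int set)"
      using mode_imp_continuous by (intro dim_dirac_ker_le) blast+
    with dim False show False by simp
  qed
  have U0: "(U \<longlongrightarrow> 0) at_infinity"
  proof -
    obtain C where "eventually (\<lambda>x. norm (U x) \<le> C * norm (exp (- \<bar>x\<bar>))) at_infinity"
      using assms(1) by (auto elim!: landau_o.bigE)
    moreover have "((\<lambda>x::real. C * norm (exp (- \<bar>x\<bar>))) \<longlongrightarrow> 0) at_infinity"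
      using tendsto_mult[OF tendsto_const[of C] exp_minus_abs_tendsto_0] by simp
    ultimately show ?thesis by (rule Lim_null_comparison)
  qed
  define K where "K = {n::int. \<exists>f g :: real \<Rightarrow> real. bound_state u (n + 1/2) f g}"
  have dimK: "2 * N \<le> card K" if "finite K"
  proof -
    have "spinor.dim (dirac_ker (\<lambda>(x, y). U x)) \<le> card K"
    proof (rule dim_dirac_ker_le[OF that])
      show "\<exists>f g :: real \<Rightarrow> real. bound_state (\<lambda>x. 2 * U x) (of_int n + 1/2) f g" if "n \<in> K" for n
        using that by (simp add: K_def u_def)
      show "mode n (\<lambda>q. \<psi> q $ 1) x = 0 \<and> mode n (\<lambda>q. \<psi> q $ 2) x = 0"
        if "\<psi> \<in> dirac_ker (\<lambda>(x, y). U x)" "n \<notin> K" for \<psi> n x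
        using mode_imp_real_bound_state[OF that(1), of n x] that(2) unfolding K_def u_def by blast
    qed
    with dim show ?thesis by simp
  qed
  \<comment> \<open>The half-integer -(n + 1/2) has index -n - 1, so the pairing exchanges
    nonnegative and negative indices without fixed points.\<close>
  have sym: "- n - 1 \<in> K" if nK: "n \<in> K" for n
  proof -
    obtain f g :: "real \<Rightarrow> real" where b: "bound_state u (n + 1/2) f g"
      using nK unfolding K_def by blast
    then have "bound_state u (- (n + 1/2)) g (\<lambda>x. - f x)"
      using zs_swap_neg[of u "n + 1/2" f g] tendsto_minus[of f 0 at_infinity]
      unfolding bound_state_def minus_zero neg_equal_0_iff_equal by blast
    moreover have "- (n + 1/2) = real_of_int (- n - 1) + 1/2" by simp
    ultimately have "bound_state u (real_of_int (- n - 1) + 1/2) g (\<lambda>x. - f x)" by (simp only:)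
    then show ?thesis unfolding K_def by blast
  qed
  define P where "P = {n \<in> K. n \<ge> 0}"
  \<comment> \<open>If \<open>P\<close> is finite, the pairing gives card K <= 2 card P, and the
    dimension bound yields N <= card P. If \<open>P\<close> is infinite, any \<open>N\<close> of its
    elements serve.\<close>
  obtain S where S: "finite S" "card S = N" "S \<subseteq> P"
  proof (cases "finite P")
    case True
    have "K \<subseteq> P \<union> (\<lambda>n. - n - 1) ` P"
    proof
      fix n assume "n \<in> K"
      with sym[of n] show "n \<in> P \<union> (\<lambda>n. - n - 1) ` P"
        by (cases "n \<ge> 0") (auto simp: P_def intro!: image_eqI[of _ _ "- n - 1"])
    qed
    with True have "finite K" "card K \<le> card (P \<union> (\<lambda>n. - n - 1) ` P)"
      by (auto intro: finite_subset card_mono)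
    moreover have "card (P \<union> (\<lambda>n. - n - 1) ` P) \<le> card P + card P"
      using card_Un_le[of P "(\<lambda>n. - n - 1) ` P"] card_image_le[OF True, of "\<lambda>n. - n - 1"] by linarith
    ultimately have "N \<le> card P" using dimK by simp
    from obtain_subset_with_card_n[OF this] that show ?thesis by blast
  next
    case False
    from infinite_arbitrarily_large[OF this, of N] that show ?thesis by blast
  qed
  have inj: "inj_on (\<lambda>n::int. real_of_int n + 1/2) S" by (auto simp: inj_on_def)
  \<comment> \<open>Since u = 2 U, the integral of u^2 is four times that of U^2, which cancels the
    4 of the trace inequality.\<close>
  have "4 * (LBINT x. (U x)\<^sup>2) \<ge> 4 * (\<Sum>n\<in>S. real_of_int n + 1/2)"
  proof (rule field_le_epsilon)
    fix e :: real assume e: "e > 0"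
    have "eventually (\<lambda>b. integral {-b..b} (\<lambda>x. (u x)\<^sup>2) \<ge> 4 * (\<Sum>k\<in>(\<lambda>n. real_of_int n + 1/2) ` S. k) - e) at_top"
    proof (rule trace_inequality)
      show "(u \<longlongrightarrow> 0) at_infinity" unfolding u_def by (rule tendsto_eq_intros U0 | simp)+
      show "continuous_on UNIV u" unfolding u_def by (intro continuous_intros cU)
    qed (use S e in \<open>auto simp: P_def K_def\<close>)
    then obtain b where b: "integral {-b..b} (\<lambda>x. (u x)\<^sup>2) \<ge> 4 * (\<Sum>n\<in>S. real_of_int n + 1/2) - e"
      unfolding sum.reindex[OF inj] eventually_at_top_linorder o_def by auto
    have i: "integrable lborel (\<lambda>x. (U x)\<^sup>2)"
      by (rule square_integrable_bigo_exp[OF cU assms(1)])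
    have si: "set_integrable lborel {-b..b} (\<lambda>x. (U x)\<^sup>2)"
      unfolding set_integrable_def by (intro integrable_mult_indicator i) simp
    have "integral {-b..b} (\<lambda>x. (u x)\<^sup>2) = 4 * integral {-b..b} (\<lambda>x. (U x)\<^sup>2)"
      by (simp add: u_def power_mult_distrib)
    also have "\<dots> = 4 * (LBINT x:{-b..b}. (U x)\<^sup>2)"
      using set_borel_integral_eq_integral(2)[OF si] by simp
    also have "\<dots> \<le> 4 * (LBINT x. (U x)\<^sup>2)"
      unfolding set_lebesgue_integral_def
      using si[unfolded set_integrable_def]
      by (intro mult_left_mono integral_mono i) (auto simp: indicator_def)
    finally show "4 * (\<Sum>n\<in>S. real_of_int n + 1/2) \<le> 4 * (LBINT x. (U x)\<^sup>2) + e"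
      using b by simp
  qed
  moreover have "(\<Sum>n\<in>S. real_of_int n + 1/2) \<ge> (real N)\<^sup>2 / 2"
    using sum_half_integers_ge[OF S(1)] S(2,3) by (force simp: P_def)
  ultimately show ?thesis by simp
qed

end
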